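(* Let $\mathbb{F}$ be a field, and let $m\ge2$, $d\ge3$ be integers. Let $\mathcal{T}\in\mathbb{F}^{m^{\times d}}\setminus\{0\}$ and $\mathcal{S}\in\mathrm{S}(m,d,\mathbb{F})\setminus\{0\}$ have decompositions $$\mathcal{T}=\sum_{j=1}^r\otimes_{i=1}^d\mathbf{x}_{i,j},\qquad \mathcal{S}=\sum_{j=1}^s t_j\otimes^d\mathbf{u}_j,$$ with $\mathbf{x}_{i,j},\mathbf{u}_j\in\mathbb{F}^m\setminus\{\mathbf{0}\}$ and $t_j\in\mathbb{F}\setminus\{0\}$, which are $(1,\lfloor\frac{d-1}{2}\rfloor,\lceil\frac{d-1}{2}\rceil)$-generic. 1. Let $d=2b+1\ge3$. Then $\mathrm{rank}\,\mathcal{T}=r$ if $r\le m^b+\frac{m-2}{2}$, and $\mathrm{rank}\,\mathcal{S}=\mathrm{srank}\,\mathcal{S}=s$ if $s\le\binom{m+b-1}{b}+\frac{m-2}{2}$. 2. Let $d=2b+2\ge4$. Then $\mathrm{rank}\,\mathcal{T}=r$ if $r\le m^b+m-2$, and $\mathrm{rank}\,\mathcal{S}=\mathrm{srank}\,\mathcal{S}=s$ if $s\le\binom{m+b-1}{b}+m-2$. Moreover, if $d=2b+1\ge3$ and $r\le m^b+\frac{m-2}{2}$, or if $d=2b+2\ge4$ and $r\le m^b+m-2$, then the representation of $\mathcal{T}$ as a sum of $r$ rank one tensors is unique up to a permutation of the summands; and if $d=2b+1\ge3$ and $s\le\binom{m+b-1}{b}+\frac{m-2}{2}$, or if $d=2b+2\ge4$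 and $s\le\binom{m+b-1}{b}+m-2$, then the representation of $\mathcal{S}$ as a sum of $s$ rank one tensors is unique up to a permutation of the summands.
   Context: $\mathbb{F}^{m^{\times d}}=\otimes^d\mathbb{F}^m$ is the space of $d$-mode tensors and $\mathrm{S}(m,d,\mathbb{F})$ its subspace of symmetric tensors; $\otimes_{i=1}^d\mathbf{x}_i=\mathbf{x}_1\otimes\cdots\otimes\mathbf{x}_d$, $\otimes^d\mathbf{u}=\mathbf{u}\otimes\cdots\otimes\mathbf{u}$ ($d$ factors). $\mathrm{rank}\,\mathcal{T}$ is the minimal $r$ for which $\mathcal{T}=\sum_{j=1}^r\otimes_{i=1}^d\mathbf{x}_{i,j}$ with nonzero $\mathbf{x}_{i,j}\in\mathbb{F}^m$; $\mathrm{srank}\,\mathcal{S}$ is the minimal $s$ for which $\mathcal{S}=\sum_{j=1}^st_j\otimes^d\mathbf{u}_j$ with $t_j\in\mathbb{F}\setminus\{0\}$ and nonzero $\mathbf{u}_j\in\mathbb{F}^m$. Let $a,b,c$ be positive integers with $a+b+c=d$. The decomposition of $\mathcal{T}$ is $(a,b,c)$-generic if: any $\min(m^a,r)$ vectors out of $\otimes_{i=1}^a\mathbf{x}_{i,1},\ldots,\otimes_{i=1}^a\mathbf{x}_{i,r}$ are linearly independent; any $\min(m^b,r)$ vectors out of $\otimes_{i=a+1}^{a+b}\mathbf{x}_{i,1},\ldots,\otimes_{i=a+1}^{a+b}\mathbf{x}_{i,r}$ are linearly independent; any $\min(m^c,r)$ vectors out of $\otimes_{i=a+b+1}^d\mathbf{x}_{i,1},\ldots,\otimes_{i=a+b+1}^d\mathbf{x}_{i,r}$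 are linearly independent. The decomposition of $\mathcal{S}$ is $(a,b,c)$-generic if: each $t_j=1$ when $\mathbb{F}$ is algebraically closed, and each $t_j=\pm1$ when $\mathbb{F}=\mathbb{R}$; and for each $e\in\{a,b,c\}$ any $\min\big(\binom{m+e-1}{e},s\big)$ vectors out of $\otimes^e\mathbf{u}_1,\ldots,\otimes^e\mathbf{u}_s$ are linearly independent. *)

theory Defs
  imports
    "HOL-Analysis.Finite_Cartesian_Product"
    "HOL-Library.Function_Algebras"
    "HOL-Library.Multiset"
    "HOL-Computational_Algebra.Polynomial"
    "HOL-Combinatorics.Permutations"
begin

text \<open>
  With \<open>m = CARD('m)\<close>, a \<open>d\<close>-mode tensor over \<open>'a\<close> is its array of entries, indexed by the
  lists over \<open>'m\<close> of length \<open>d\<close>.  All orders live in the one type \<open>'m list \<Rightarrow> 'a\<close>, a tensor of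
  order \<open>d\<close> being zero on lists of any other length; addition and \<open>0\<close> are pointwise.
\<close>

type_synonym ('a, 'm) tensor = "'m list \<Rightarrow> 'a"

definition tensors :: "nat \<Rightarrow> ('a::field, 'm::finite) tensor set" where
  "tensors d = {T. \<forall>is. length is \<noteq> d \<longrightarrow> T is = 0}"

definition symmetric_tensors :: "nat \<Rightarrow> ('a::field, 'm::finite) tensor set" where
  "symmetric_tensors d = {S \<in> tensors d. \<forall>is js. mset is = mset js \<longrightarrow> S is = S js}"

definition tscale :: "'a::field \<Rightarrow> ('a, 'm::finite) tensor \<Rightarrow> ('a, 'm) tensor" where
  "tscale c T = (\<lambda>is. c * T is)"

interpretation tensor: vector_space tscale
  by unfold_locales (auto simp: tscale_def fun_eq_iff algebra_simps)

definition tensor_product :: "('a::field ^ 'm::finite) list \<Rightarrow> ('a, 'm) tensor" where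
  "tensor_product vs =
     (\<lambda>is. if length is = length vs then \<Prod>k<length vs. (vs ! k) $ (is ! k) else 0)"

definition tensor_segment ::
    "(nat \<Rightarrow> nat \<Rightarrow> 'a::field ^ 'm::finite) \<Rightarrow> nat \<Rightarrow> nat \<Rightarrow> nat \<Rightarrow> ('a, 'm) tensor" where
  \<comment> \<open>\<open>x i j\<close> is the factor \<open>x\<^sub>i\<^sub>,\<^sub>j\<close> of the \<open>j\<close>-th summand in mode \<open>i\<close>; modes and summands are
      numbered from \<open>1\<close>, and the product is over the modes \<open>l, \<dots>, h\<close>.\<close>
  "tensor_segment x l h j = tensor_product (map (\<lambda>i. x i j) [l..<Suc h])"

definition tensor_power :: "nat \<Rightarrow> 'a::field ^ 'm::finite \<Rightarrow> ('a, 'm) tensor" where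
  "tensor_power e u = tensor_product (replicate e u)"

definition decomposition ::
    "nat \<Rightarrow> nat \<Rightarrow> (nat \<Rightarrow> nat \<Rightarrow> 'a::field ^ 'm::finite) \<Rightarrow> ('a, 'm) tensor \<Rightarrow> bool" where
  "decomposition d r x T \<longleftrightarrow>
     (\<forall>i\<in>{1..d}. \<forall>j\<in>{1..r}. x i j \<noteq> 0) \<and> T = (\<Sum>j=1..r. tensor_segment x 1 d j)"

definition symmetric_decomposition ::
    "nat \<Rightarrow> nat \<Rightarrow> (nat \<Rightarrow> 'a) \<Rightarrow> (nat \<Rightarrow> 'a::field ^ 'm::finite) \<Rightarrow> ('a, 'm) tensor \<Rightarrow> bool" where
  "symmetric_decomposition d s t u S \<longleftrightarrow>
     (\<forall>j\<in>{1..s}. t j \<noteq> 0 \<and> u j \<noteq> 0) \<and> S = (\<Sum>j=1..s. tscale (t j) (tensor_power d (u j)))"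

definition tensor_rank :: "nat \<Rightarrow> ('a::field, 'm::finite) tensor \<Rightarrow> nat" where
  "tensor_rank d T = (LEAST r. \<exists>x. decomposition d r x T)"

text \<open>
  Over a small finite field a symmetric tensor may have no symmetric decomposition;
  \<open>symmetric_rank\<close> is then an unspecified number.
\<close>

definition symmetric_rank :: "nat \<Rightarrow> ('a::field, 'm::finite) tensor \<Rightarrow> nat" where
  "symmetric_rank d S = (LEAST s. \<exists>t u. symmetric_decomposition d s t u S)"

definition any_independent :: "nat \<Rightarrow> nat \<Rightarrow> (nat \<Rightarrow> ('a::field, 'm::finite) tensor) \<Rightarrow> bool" where
  \<comment> \<open>any \<open>k\<close> out of \<open>v\<^sub>1, \<dots>, v\<^sub>r\<close> are linearly independent; injectivity excludes repeated
      vectors, which the independence of the image as a set does not see\<close>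
  "any_independent k r v \<longleftrightarrow>
     (\<forall>J. J \<subseteq> {1..r} \<and> card J = k \<longrightarrow> inj_on v J \<and> tensor.independent (v ` J))"

definition generic ::
    "nat \<Rightarrow> nat \<Rightarrow> nat \<Rightarrow> nat \<Rightarrow> (nat \<Rightarrow> nat \<Rightarrow> 'a::field ^ 'm::finite) \<Rightarrow> bool" where
  "generic a b c r x \<longleftrightarrow>
     any_independent (min (CARD('m) ^ a) r) r (tensor_segment x 1 a) \<and>
     any_independent (min (CARD('m) ^ b) r) r (tensor_segment x (a + 1) (a + b)) \<and>
     any_independent (min (CARD('m) ^ c) r) r (tensor_segment x (a + b + 1) (a + b + c))"

definition algebraically_closed :: "'a::field itself \<Rightarrow> bool" where
  "algebraically_closed _ \<longleftrightarrow> (\<forall>p::'a poly. degree p > 0 \<longrightarrow> (\<exists>z. poly p z = 0))"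

text \<open>Equality of types is not a proposition, so the case of the real field is expressed by a
  field isomorphism.\<close>

definition is_real_field :: "'a::field itself \<Rightarrow> bool" where
  "is_real_field _ \<longleftrightarrow>
     (\<exists>h::'a \<Rightarrow> real. bij h \<and> (\<forall>x y. h (x + y) = h x + h y \<and> h (x * y) = h x * h y))"

definition symmetric_generic ::
    "nat \<Rightarrow> nat \<Rightarrow> nat \<Rightarrow> nat \<Rightarrow> (nat \<Rightarrow> 'a) \<Rightarrow> (nat \<Rightarrow> 'a::field ^ 'm::finite) \<Rightarrow> bool" where
  "symmetric_generic a b c s t u \<longleftrightarrow>
     (algebraically_closed TYPE('a) \<longrightarrow> (\<forall>j\<in>{1..s}. t j = 1)) \<and>
     (is_real_field TYPE('a) \<longrightarrow> (\<forall>j\<in>{1..s}. t j = 1 \<or> t j = - 1)) \<and>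
     (\<forall>e\<in>{a, b, c}.
        any_independent (min ((CARD('m) + e - 1) choose e) s) s (\<lambda>j. tensor_power e (u j)))"

definition rank_one_tensors :: "nat \<Rightarrow> ('a::field, 'm::finite) tensor set" where
  "rank_one_tensors d = {tensor_product vs | vs. length vs = d \<and> 0 \<notin> set vs}"

definition rank_one_sum ::
    "nat \<Rightarrow> nat \<Rightarrow> (nat \<Rightarrow> ('a::field, 'm::finite) tensor) \<Rightarrow> ('a, 'm) tensor \<Rightarrow> bool" where
  "rank_one_sum d r A T \<longleftrightarrow> (\<forall>j\<in>{1..r}. A j \<in> rank_one_tensors d) \<and> T = (\<Sum>j=1..r. A j)"

definition unique_rank_one_sum :: "nat \<Rightarrow> nat \<Rightarrow> ('a::field, 'm::finite) tensor \<Rightarrow> bool" where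
  "unique_rank_one_sum d r T \<longleftrightarrow>
     (\<exists>A. rank_one_sum d r A T) \<and>
     (\<forall>A B. rank_one_sum d r A T \<and> rank_one_sum d r B T \<longrightarrow>
        (\<exists>\<pi>. \<pi> permutes {1..r} \<and> (\<forall>j\<in>{1..r}. B j = A (\<pi> j))))"

end

theory Submission
  imports Defs
begin

text \<open>
  Group the \<open>d\<close> modes into three blocks, of sizes \<open>1\<close>, \<open>\<lfloor>(d - 1) / 2\<rfloor>\<close> and \<open>\<lceil>(d - 1) / 2\<rceil>\<close>.  A rank
  one tensor of order \<open>d\<close> becomes an outer product of three vectors, and the theorem becomes an
  instance of Kruskal's theorem: \<open>r\<close> outer products whose three families of factors have \<open>k\<close>-ranks
  with sum at least \<open>2 r + 2\<close> form the only shortest decomposition of their sum.  Here the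
  \<open>k\<close>-rank is the largest \<open>k\<close> such that any \<open>k\<close> of the factors are independent.  Genericity
  bounds the \<open>k\<close>-ranks from below, and the assumed bounds on \<open>r\<close> and \<open>s\<close> make the sum large
  enough when there are at least two summands; for a single nonzero summand the claim is immediate.
  A symmetric decomposition is an ordinary one after its coefficients are moved into the first
  block, so the symmetric case follows with binomial coefficients in place of powers of \<open>m\<close>.

  Kruskal's theorem is proved over an arbitrary field by the method of Lovitz and Petrov.  Its core
  is a lower bound for the dimension of the span of outer products
  \<open>a\<^sub>i \<otimes> b\<^sub>i \<otimes> c\<^sub>i\<close>: unless the span is a direct sum of the spans of two proper subfamilies,
  it is at least the sum of the dimensions of the spans of the three families of factors, minus \<open>2\<close>
  (\<open>dim_outer3_ge\<close>).  The case of two factors (\<open>dim_outer_ge\<close>) is proved by building up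
  the family from a single member, adding in each step a smallest set of members linked to the present ones.

  Given two decompositions of one tensor, all summands together satisfy a linear relation.
  Split them as long as possible; each part is then again an identity between \<open>p\<close> summands of the
  first and \<open>q\<close> summands of the second decomposition.  The lower bound and Kruskal's inequality give
  \<open>p < q\<close> whenever \<open>p \<ge> 2\<close>.  So the second decomposition is never
  shorter, and if it is equally long, then every part says that one summand of the first
  equals one summand of the second (\<open>kruskal\<close>).
\<close>

section \<open>Dimensions of finite families\<close>

context vector_space
begin

lemma span_image_iff_sum:
  assumes "finite J"
  shows "w \<in> span (v ` J) \<longleftrightarrow> (\<exists>c. w = (\<Sum>j\<in>J. scale (c j) (v j)))"
  using assms
proof (induction J arbitrary: w rule: finite_induct)
  case (insert i J)
  show ?case
  proof
    assume "w \<in> span (v ` insert i J)"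
    then obtain k where "w - scale k (v i) \<in> span (v ` J)"
      by (auto simp: span_insert)
    with insert.IH obtain c where "w - scale k (v i) = (\<Sum>j\<in>J. scale (c j) (v j))" by blast
    moreover have "(\<Sum>j\<in>J. scale (c j) (v j)) = (\<Sum>j\<in>J. scale ((c(i := k)) j) (v j))"
      using insert.hyps by (intro sum.cong) auto
    ultimately have "w = (\<Sum>j\<in>insert i J. scale ((c(i := k)) j) (v j))"
      using insert.hyps by (simp add: algebra_simps)
    then show "\<exists>c. w = (\<Sum>j\<in>insert i J. scale (c j) (v j))" by blast
  qed (auto intro!: span_sum span_scale intro: span_base)
qed simp

text \<open>
  Only spans of finite sets occur, so dimensions can be computed by adding vectors one at a time,
  although the ambient spaces of functions are infinite-dimensional.
\<close>

lemma dim_insert_finite: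
  assumes "finite S"
  shows "dim (insert x S) = (if x \<in> span S then dim S else dim S + 1)"
proof (cases "x \<in> span S")
  case True
  then show ?thesis by (simp add: span_eq_dim[OF span_redundant])
next
  case False
  obtain B where B: "B \<subseteq> S" "independent B" "S \<subseteq> span B" "card B = dim S"
    using basis_exists by blast
  have spB: "span B = span S"
    using B(1,3) by (simp add: span_eq span_mono span_superset subset_trans)
  have "finite B" using B(1) assms finite_subset by blast
  moreover have "x \<notin> B" using False spB span_base by blast
  moreover have "dim (insert x S) = card (insert x B)"
  proof (rule dim_eq_card)
    show "span (insert x B) = span (insert x S)" by (simp add: span_insert spB)
    show "independent (insert x B)" using B(2) False spB by (simp add: independent_insertI)
  qed
  ultimately show ?thesis using False B(4) by simp
qed

lemma dim_Un_le_add_card: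
  assumes "finite S" "finite X"
  shows "dim (S \<union> X) \<le> dim S + card X"
  using assms(2) by (induction X rule: finite_induct) (auto simp: dim_insert_finite assms(1))

lemma dim_mono_finite:
  assumes "finite T" "S \<subseteq> T"
  shows "dim S \<le> dim T"
proof -
  have "finite S" using assms finite_subset by blast
  have "dim S \<le> dim (S \<union> X)" if "finite X" for X
    using that by (induction X rule: finite_induct) (auto simp: dim_insert_finite \<open>finite S\<close>)
  from this[of T] show ?thesis using assms by (simp add: Un_absorb1)
qed

lemma dim_add_card_le_relative:
  assumes "finite S" "finite L"
    and indep: "\<And>c. (\<Sum>j\<in>L. scale (c j) (v j)) \<in> span (v ` S) \<Longrightarrow> \<forall>j\<in>L. c j = 0"
  shows "dim (v ` S) + card L \<le> dim (v ` (S \<union> L))"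
  using assms(2,3)
proof (induction L rule: finite_induct)
  case (insert i L)
  have *: "\<forall>j\<in>L. c j = 0" if "(\<Sum>j\<in>L. scale (c j) (v j)) \<in> span (v ` S)" for c
  proof -
    have "(\<Sum>j\<in>insert i L. scale ((c(i := 0)) j) (v j)) = (\<Sum>j\<in>L. scale ((c(i := 0)) j) (v j))"
      using insert.hyps by simp
    also have "\<dots> = (\<Sum>j\<in>L. scale (c j) (v j))"
      using insert.hyps by (intro sum.cong) auto
    finally have "\<forall>j\<in>insert i L. (c(i := 0)) j = 0"
      using insert.prems[of "c(i := 0)"] that by simp
    then show ?thesis using insert.hyps by (metis fun_upd_other insertCI)
  qed
  have "v i \<notin> span (v ` (S \<union> L))"
  proof
    assume "v i \<in> span (v ` (S \<union> L))"
    then obtain p q where pq: "p \<in> span (v ` S)" "q \<in> span (v ` L)" "v i = p + q"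
      by (auto simp: image_Un span_Un)
    then obtain c where c: "q = (\<Sum>j\<in>L. scale (c j) (v j))"
      using span_image_iff_sum[OF insert.hyps(1)] by blast
    have "(\<Sum>j\<in>insert i L. scale (((\<lambda>j. - c j)(i := 1)) j) (v j))
        = v i + (\<Sum>j\<in>L. scale (((\<lambda>j. - c j)(i := 1)) j) (v j))"
      using insert.hyps by simp
    also have "(\<Sum>j\<in>L. scale (((\<lambda>j. - c j)(i := 1)) j) (v j)) = (\<Sum>j\<in>L. - (scale (c j) (v j)))"
      using insert.hyps by (intro sum.cong) auto
    also have "v i + \<dots> = p" using pq c by (simp add: sum_negf)
    finally have "(\<Sum>j\<in>insert i L. scale (((\<lambda>j. - c j)(i := 1)) j) (v j)) \<in> span (v ` S)"
      using pq by simp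
    from insert.prems[OF this] show False by auto
  qed
  moreover have "dim (v ` S) + card L \<le> dim (v ` (S \<union> L))" using insert.IH * by blast
  ultimately show ?case
    using insert.hyps assms(1) by (simp add: dim_insert_finite)
qed simp

lemma dim_le_add_card_relative:
  assumes "finite S" "finite L" "L \<subseteq> J" "v ` J \<subseteq> span (v ` (S \<union> L))"
  shows "dim (v ` (S \<union> J)) \<le> dim (v ` S) + card L"
proof -
  have "v ` S \<subseteq> span (v ` (S \<union> L))"
    by (meson Un_upper1 image_mono span_superset subset_trans)
  moreover have "v ` (S \<union> L) \<subseteq> span (v ` (S \<union> J))"
    using assms(3) by (intro subset_trans[OF _ span_superset] image_mono) auto
  ultimately have "span (v ` (S \<union> J)) = span (v ` (S \<union> L))"
    unfolding span_eq using assms(4) by (simp add: image_Un)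
  then have "dim (v ` (S \<union> J)) = dim (v ` S \<union> v ` L)"
    unfolding image_Un by (rule span_eq_dim)
  also have "\<dots> \<le> dim (v ` S) + card (v ` L)"
    using assms(1,2) by (intro dim_Un_le_add_card) auto
  also have "\<dots> \<le> dim (v ` S) + card L"
    using assms(2) card_image_le by simp
  finally show ?thesis .
qed

lemma separating_functional:
  assumes "v \<notin> span X"
  shows "\<exists>\<phi>. Vector_Spaces.linear scale (*) \<phi> \<and> (\<forall>x\<in>X. \<phi> x = 0) \<and> \<phi> v = 1"
proof -
  interpret pair: vector_space_pair scale "(*)"
    by unfold_locales (auto simp: algebra_simps)
  obtain B where B: "B \<subseteq> X" "independent B" "X \<subseteq> span B"
    using maximal_independent_subset by blast
  have "v \<notin> span B" using assms B(1) span_mono by blast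
  then have ind: "independent (insert v B)" and "v \<notin> B"
    using B(2) by (auto simp: independent_insertI intro: span_base)
  obtain \<phi> where \<phi>: "Vector_Spaces.linear scale (*) \<phi>" "\<forall>x\<in>insert v B. \<phi> x = (if x = v then 1 else 0)"
    using pair.linear_independent_extend[OF ind, of "\<lambda>x. if x = v then 1 else 0"] by blast
  interpret lin: Vector_Spaces.linear scale "(*)" \<phi> by (rule \<phi>(1))
  have "\<phi> x = 0" if "x \<in> X" for x
  proof -
    have "x \<in> span B" using that B(3) by blast
    then show ?thesis
    proof (induction rule: span_induct_alt)
      case (step c y z)
      then show ?case using \<phi>(2) \<open>v \<notin> B\<close> by (auto simp: lin.add lin.scale)
    qed (rule lin.zero)
  qed
  with \<phi> show ?thesis by auto
qed

lemma separating_functional_sum: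
  assumes "v \<notin> span X"
  obtains \<phi> where "\<And>c w J. \<phi> (\<Sum>j\<in>J. scale (c j) (w j)) = (\<Sum>j\<in>J. c j * \<phi> (w j))"
    "\<And>x. x \<in> X \<Longrightarrow> \<phi> x = 0" "\<phi> v = 1"
proof -
  from separating_functional[OF assms] obtain \<phi> where \<phi>: "Vector_Spaces.linear scale (*) \<phi>"
    "\<forall>x\<in>X. \<phi> x = 0" "\<phi> v = 1" by blast
  interpret lin: Vector_Spaces.linear scale "(*)" \<phi> by (rule \<phi>(1))
  show thesis using \<phi>(2,3) by (intro that[of \<phi>]) (auto simp: lin.sum lin.scale)
qed

end


section \<open>Splitting and the dimension of a family of outer products\<close>

text \<open>
  The scaling of tensors, but over an arbitrary index type: an outer product of functions on \<open>'x\<close>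
  and \<open>'y\<close> is a function on \<open>'x \<times> 'y\<close>.
\<close>

definition fscale :: "'a::field \<Rightarrow> ('x \<Rightarrow> 'a) \<Rightarrow> 'x \<Rightarrow> 'a" where
  "fscale c f = (\<lambda>x. c * f x)"

interpretation fun_space: vector_space fscale
  by unfold_locales (auto simp: fscale_def fun_eq_iff algebra_simps)

definition outer :: "('x \<Rightarrow> 'a::field) \<Rightarrow> ('y \<Rightarrow> 'a) \<Rightarrow> 'x \<times> 'y \<Rightarrow> 'a" where
  "outer a b = (\<lambda>(x, y). a x * b y)"

text \<open>
  A family splits when the matroid of its vectors is disconnected, that is, when its span is the
  direct sum of the spans of two nonempty complementary subfamilies.
\<close>

definition splits :: "('i \<Rightarrow> 'x \<Rightarrow> 'a::field) \<Rightarrow> 'i set \<Rightarrow> bool" where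
  "splits z I \<longleftrightarrow>
     (\<exists>S\<subset>I. S \<noteq> {} \<and> fun_space.span (z ` S) \<inter> fun_space.span (z ` (I - S)) \<subseteq> {0})"

lemma sum_fun_apply: "(\<Sum>j\<in>J. f j) x = (\<Sum>j\<in>J. f j x)"
  by (induction J rule: infinite_finite_induct) auto

text \<open>
  Slicing is linear and turns \<open>a\<^sub>i \<otimes> b\<^sub>i\<close> into a multiple of \<open>b\<^sub>i\<close>.
\<close>

lemma slice_in_span:
  assumes "finite S" "v \<in> fun_space.span ((\<lambda>i. outer (a i) (b i)) ` S)"
  shows "(\<lambda>y. v (x, y)) \<in> fun_space.span (b ` S)"
proof -
  obtain c where v: "v = (\<Sum>j\<in>S. fscale (c j) (outer (a j) (b j)))"
    using assms(2) unfolding fun_space.span_image_iff_sum[OF assms(1)] by blast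
  have "(\<lambda>y. v (x, y)) = (\<Sum>j\<in>S. fscale (c j * a j x) (b j))"
    unfolding v by (auto simp: fun_eq_iff fscale_def outer_def sum_fun_apply mult.assoc)
  then show ?thesis unfolding fun_space.span_image_iff_sum[OF assms(1)]
    by (intro exI[of _ "\<lambda>j. c j * a j x"])
qed

text \<open>
  A tensor common to the spans over \<open>S\<close> and over \<open>I - S\<close> has all its slices in the zero
  intersection of the spans of the \<open>b\<^sub>i\<close>.
\<close>

lemma splits_outer:
  assumes "finite I" "splits b I"
  shows "splits (\<lambda>i. outer (a i) (b i)) I"
proof -
  obtain S where S: "S \<subset> I" "S \<noteq> {}"
    "fun_space.span (b ` S) \<inter> fun_space.span (b ` (I - S)) \<subseteq> {0}"
    using assms(2) unfolding splits_def by blast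
  have fin: "finite S" "finite (I - S)" using S(1) assms(1) finite_subset by auto
  have "v = 0" if "v \<in> fun_space.span ((\<lambda>i. outer (a i) (b i)) ` S)"
    "v \<in> fun_space.span ((\<lambda>i. outer (a i) (b i)) ` (I - S))" for v
  proof -
    have "(\<lambda>y. v (x, y)) = 0" for x
      using slice_in_span[OF fin(1) that(1)] slice_in_span[OF fin(2) that(2)] S(3) by blast
    then show ?thesis by (simp add: fun_eq_iff)
  qed
  then show ?thesis unfolding splits_def using S(1,2) by blast
qed

text \<open>
  The analogue of an ear of a graph.  Since \<open>z\<close> does not split, the spans over \<open>S\<close> and over its
  complement share a nonzero vector; \<open>J\<close> is a smallest subset of the complement that supports one.
  By minimality, the coefficients of the shared vector are nonzero and, up to the shared
  vector itself, \<open>J\<close> is independent modulo \<open>S\<close>, so that adding \<open>J\<close> to \<open>S\<close> raises the dimension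
  by \<open>card J - 1\<close> at least.
\<close>

lemma minimal_link:
  fixes z :: "'i \<Rightarrow> 'x \<Rightarrow> 'a::field"
  assumes I: "finite I" and S: "S \<subset> I" "S \<noteq> {}" and ns: "\<not> splits z I"
  obtains J c where "J \<subseteq> I - S" "J \<noteq> {}" "\<forall>j\<in>J. c j \<noteq> 0"
    "(\<Sum>j\<in>J. fscale (c j) (z j)) \<noteq> 0"
    "(\<Sum>j\<in>J. fscale (c j) (z j)) \<in> fun_space.span (z ` S)"
    "fun_space.dim (z ` S) + card J \<le> fun_space.dim (z ` (S \<union> J)) + 1"
proof -
  let ?lc = "\<lambda>c J. \<Sum>j\<in>J. fscale (c j) (z j)"
  define link where "link J \<longleftrightarrow> J \<subseteq> I - S \<and>
    (\<exists>c. ?lc c J \<noteq> 0 \<and> ?lc c J \<in> fun_space.span (z ` S))" for J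
  have finS: "finite S" using S(1) I finite_subset by blast
  obtain v where v: "v \<in> fun_space.span (z ` S)" "v \<in> fun_space.span (z ` (I - S))" "v \<noteq> 0"
    using ns S unfolding splits_def by blast
  then have "link (I - S)"
    unfolding link_def using I fun_space.span_image_iff_sum[of "I - S" v z] by auto
  from ex_has_least_nat[of link _ card, OF this]
  obtain J where J: "link J" and min: "\<And>J'. link J' \<Longrightarrow> card J \<le> card J'" by blast
  have JI: "J \<subseteq> I - S" and finJ: "finite J"
    using J I finite_subset unfolding link_def by auto
  obtain c where c: "?lc c J \<noteq> 0" "?lc c J \<in> fun_space.span (z ` S)"
    using J unfolding link_def by blast
  \<comment> \<open>Both consequences of minimality that follow: no shared vector is supported on \<open>J\<close> with an
    index removed, hence no expansion of the vector found over \<open>J\<close> has a zero coefficient.\<close>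
  have not_smaller: False
    if "j \<in> J" "?lc e (J - {j}) \<noteq> 0" "?lc e (J - {j}) \<in> fun_space.span (z ` S)" for e j
  proof -
    have "link (J - {j})" unfolding link_def using that JI by blast
    from min[OF this] show False
      using card_Diff1_less[OF finJ that(1)] by simp
  qed
  have not_zero: "e j \<noteq> 0" if "j \<in> J" "?lc e J = ?lc c J" for e j
  proof
    assume "e j = 0"
    then have "?lc e (J - {j}) = ?lc e J"
      using that(1) by (simp add: sum.remove[OF finJ that(1)])
    with that not_smaller[of j e] c show False by simp
  qed
  have "J \<noteq> {}" using c by auto
  then obtain j0 where j0: "j0 \<in> J" by blast
  have indep: "\<forall>j\<in>J - {j0}. d j = 0"
    if d: "?lc d (J - {j0}) \<in> fun_space.span (z ` S)" for d
  proof (rule ccontr)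
    assume "\<not> (\<forall>j\<in>J - {j0}. d j = 0)"
    then obtain j1 where j1: "j1 \<in> J" "j1 \<noteq> j0" "d j1 \<noteq> 0" by blast
    have d0: "?lc d (J - {j0}) = 0" using not_smaller[OF j0] d by blast
    have "?lc (d(j0 := 0)) J = ?lc (d(j0 := 0)) (J - {j0})"
      by (simp add: sum.remove[OF finJ j0])
    also have "\<dots> = 0" using d0 by (intro trans[OF _ d0] sum.cong) auto
    finally have d1: "?lc (d(j0 := 0)) J = 0" .
    \<comment> \<open>Subtracting the relation \<open>d\<close>, scaled to cancel the coefficient at \<open>j1\<close>, leaves the shared
      vector unchanged.\<close>
    define e where "e j = c j - c j1 / d j1 * (d(j0 := 0)) j" for j
    have "?lc e J = ?lc c J - fscale (c j1 / d j1) (?lc (d(j0 := 0)) J)"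
      unfolding e_def fun_space.scale_left_diff_distrib sum_subtractf fun_space.scale_sum_right
        fun_space.scale_scale ..
    then have "?lc e J = ?lc c J" using d1 by simp
    then show False using not_zero[of j1 e] j1 by (simp add: e_def)
  qed
  have "fun_space.dim (z ` S) + card (J - {j0}) \<le> fun_space.dim (z ` (S \<union> (J - {j0})))"
    using finJ finS indep by (intro fun_space.dim_add_card_le_relative) auto
  also have "\<dots> \<le> fun_space.dim (z ` (S \<union> J))"
    using finJ finS by (intro fun_space.dim_mono_finite) auto
  finally have "fun_space.dim (z ` S) + card J \<le> fun_space.dim (z ` (S \<union> J)) + 1"
    using j0 finJ by (simp add: card_Diff_singleton)
  then show thesis using that JI \<open>J \<noteq> {}\<close> not_zero c by blast
qed

text \<open>
  The counterpart of the preceding lemma for the two factors: adding \<open>J\<close> raises the sum of the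
  dimensions of their spans by at most \<open>card J - 1\<close>.  Let \<open>K \<subseteq> J\<close> index a basis of the
  \<open>a\<^sub>j\<close> modulo the span over \<open>S\<close>.  For \<open>k \<in> K\<close>, a functional that is \<open>1\<close> at
  \<open>a\<^sub>k\<close> and vanishes on the rest of that basis and on the \<open>a\<^sub>i\<close> with \<open>i \<in> S\<close>, applied to the
  first factor of the shared tensor \<open>v\<close>, expresses \<open>b\<^sub>k\<close> by the \<open>b\<^sub>j\<close>
  with \<open>j \<in> J - K\<close>.  So the first dimension grows by at most \<open>card K\<close> and the second by at most
  \<open>card (J - K)\<close>.  One is saved because a nonzero slice of \<open>v\<close> lies
  both in the span of the \<open>b\<^sub>j\<close> with \<open>j \<in> J - K\<close> and in the span over \<open>S\<close>.
\<close>

lemma linked_factor_dim: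
  fixes a :: "'i \<Rightarrow> 'x \<Rightarrow> 'a::field" and b :: "'i \<Rightarrow> 'y \<Rightarrow> 'a"
  defines "z \<equiv> \<lambda>i. outer (a i) (b i)"
  assumes fin: "finite S" "finite J" and c: "\<forall>j\<in>J. c j \<noteq> 0"
    and v0: "(\<Sum>j\<in>J. fscale (c j) (z j)) \<noteq> 0"
    and vS: "(\<Sum>j\<in>J. fscale (c j) (z j)) \<in> fun_space.span (z ` S)"
  shows "fun_space.dim (a ` (S \<union> J)) + fun_space.dim (b ` (S \<union> J)) + 1
    \<le> fun_space.dim (a ` S) + fun_space.dim (b ` S) + card J"
proof -
  define v where "v = (\<Sum>j\<in>J. fscale (c j) (z j))"
  define gen where "gen K \<longleftrightarrow> K \<subseteq> J \<and> a ` J \<subseteq> fun_space.span (a ` (S \<union> K))" for K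
  have "gen J" unfolding gen_def by (auto intro: fun_space.span_base)
  from ex_has_least_nat[of gen _ card, OF this]
  obtain K where K: "gen K" and min: "\<And>K'. gen K' \<Longrightarrow> card K \<le> card K'" by blast
  have KJ: "K \<subseteq> J" and finK: "finite K"
    using K fin(2) finite_subset unfolding gen_def by auto
  have dim_a: "fun_space.dim (a ` (S \<union> J)) \<le> fun_space.dim (a ` S) + card K"
    using fin finK K unfolding gen_def by (intro fun_space.dim_le_add_card_relative) auto
  from iffD1[OF fun_space.span_image_iff_sum[OF fin(1)] vS]
  obtain d where d: "v = (\<Sum>s\<in>S. fscale (d s) (z s))"
    unfolding v_def ..
  have bK: "b k \<in> fun_space.span (b ` (J - K))" if k: "k \<in> K" for k
  proof -
    have notin: "a k \<notin> fun_space.span (a ` (S \<union> (K - {k})))"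
    proof
      assume ak: "a k \<in> fun_space.span (a ` (S \<union> (K - {k})))"
      have "a ` (S \<union> K) \<subseteq> fun_space.span (a ` (S \<union> (K - {k})))"
      proof
        fix w assume "w \<in> a ` (S \<union> K)"
        then obtain i where i: "i \<in> S \<union> K" "w = a i" by blast
        show "w \<in> fun_space.span (a ` (S \<union> (K - {k})))"
        proof (cases "i = k")
          case False
          then show ?thesis using i by (intro fun_space.span_base) auto
        qed (use i ak in simp)
      qed
      then have "fun_space.span (a ` (S \<union> K)) \<subseteq> fun_space.span (a ` (S \<union> (K - {k})))"
        by (simp add: fun_space.span_minimal)
      then have "gen (K - {k})" using K unfolding gen_def by blast
      from min[OF this] show False using k finK
        by (metis card_Diff1_less not_less)
    qed
    obtain \<phi> where
      \<phi>_sum: "\<And>c' w J'. \<phi> (\<Sum>j\<in>J'. fscale (c' j) (w j)) = (\<Sum>j\<in>(J'::'i set). c' j * \<phi> (w j))"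
      and \<phi>0: "\<And>w. w \<in> a ` (S \<union> (K - {k})) \<Longrightarrow> \<phi> w = 0" and \<phi>1: "\<phi> (a k) = 1"
      by (rule fun_space.separating_functional_sum[OF notin, where ?'c = 'i]) (rule that)
    \<comment> \<open>Write \<open>v\<close> over \<open>J\<close> and over \<open>S\<close> and apply \<open>\<phi>\<close> to its slices in the first
      coordinate; the second expansion vanishes.\<close>
    have relation: "(\<Sum>j\<in>J. fscale (c j * \<phi> (a j)) (b j)) = 0"
    proof
      fix y
      have "(\<Sum>j\<in>J. fscale (c j * b j y) (a j)) = (\<lambda>x. v (x, y))"
        unfolding v_def z_def
        by (auto simp: fun_eq_iff fscale_def outer_def sum_fun_apply algebra_simps)
      also have "\<dots> = (\<Sum>j\<in>S. fscale (d j * b j y) (a j))"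
        unfolding d z_def
        by (auto simp: fun_eq_iff fscale_def outer_def sum_fun_apply algebra_simps)
      finally have "\<phi> (\<Sum>j\<in>J. fscale (c j * b j y) (a j)) = \<phi> (\<Sum>j\<in>S. fscale (d j * b j y) (a j))"
        by simp
      then have "(\<Sum>j\<in>J. c j * b j y * \<phi> (a j)) = (\<Sum>j\<in>S. d j * b j y * \<phi> (a j))"
        by (simp add: \<phi>_sum)
      also have "\<dots> = 0" using \<phi>0 by (intro sum.neutral) auto
      finally show "(\<Sum>j\<in>J. fscale (c j * \<phi> (a j)) (b j)) y = 0 y"
        by (simp add: fscale_def sum_fun_apply mult_ac)
    qed
    have split: "(\<Sum>j\<in>J. fscale (c j * \<phi> (a j)) (b j)) =
       (\<Sum>j\<in>J - K. fscale (c j * \<phi> (a j)) (b j)) + (\<Sum>j\<in>K. fscale (c j * \<phi> (a j)) (b j))"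
      using fin(2) KJ by (simp add: sum.subset_diff)
    have "(\<Sum>j\<in>K - {k}. fscale (c j * \<phi> (a j)) (b j)) = 0"
    proof (rule sum.neutral, rule ballI)
      fix j assume "j \<in> K - {k}"
      then have "\<phi> (a j) = 0" by (intro \<phi>0) auto
      then show "fscale (c j * \<phi> (a j)) (b j) = 0" by simp
    qed
    then have only_k: "(\<Sum>j\<in>K. fscale (c j * \<phi> (a j)) (b j)) = fscale (c k) (b k)"
      using sum.remove[OF finK k, of "\<lambda>j. fscale (c j * \<phi> (a j)) (b j)"]
      by (simp only: \<phi>1 add_0_right mult_1_right)
    have "(\<Sum>j\<in>J - K. fscale (c j * \<phi> (a j)) (b j)) + fscale (c k) (b k) = 0"
      using relation unfolding split only_k .
    then have "fscale (c k) (b k) = - (\<Sum>j\<in>J - K. fscale (c j * \<phi> (a j)) (b j))"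
      by (rule minus_unique[symmetric])
    also have "\<dots> \<in> fun_space.span (b ` (J - K))"
      by (intro fun_space.span_neg fun_space.span_sum fun_space.span_scale fun_space.span_base) auto
    finally have "fscale (inverse (c k)) (fscale (c k) (b k)) \<in> fun_space.span (b ` (J - K))"
      by (rule fun_space.span_scale)
    then show ?thesis using c k KJ by auto
  qed
  have spJ: "b ` J \<subseteq> fun_space.span (b ` (J - K))"
  proof
    fix w assume "w \<in> b ` J"
    then obtain j where "j \<in> J" "w = b j" by blast
    then show "w \<in> fun_space.span (b ` (J - K))"
      using bK by (cases "j \<in> K") (auto intro: fun_space.span_base)
  qed
  \<comment> \<open>The slice \<open>w\<close> of \<open>v\<close> gives a nontrivial relation modulo the span over \<open>S\<close>, which makes one index
    \<open>j0\<close> of \<open>J - K\<close> superfluous.\<close>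
  obtain x y where xy: "v (x, y) \<noteq> 0" using v0 unfolding v_def[symmetric] by (auto simp: fun_eq_iff)
  define w where "w = (\<lambda>y. v (x, y))"
  have wS: "w \<in> fun_space.span (b ` S)"
    unfolding w_def by (rule slice_in_span[OF fin(1) vS[folded v_def, unfolded z_def]])
  have vJ: "v \<in> fun_space.span (z ` J)"
    unfolding v_def by (intro fun_space.span_sum fun_space.span_scale fun_space.span_base) auto
  have "w \<in> fun_space.span (b ` J)"
    unfolding w_def by (rule slice_in_span[OF fin(2) vJ[unfolded z_def]])
  then have "w \<in> fun_space.span (b ` (J - K))"
    using spJ fun_space.span_minimal[OF _ fun_space.subspace_span] by blast
  from iffD1[OF fun_space.span_image_iff_sum[OF finite_Diff[OF fin(2)]] this]
  obtain g where g: "w = (\<Sum>j\<in>J - K. fscale (g j) (b j))" ..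
  have "w \<noteq> 0" using xy unfolding w_def by (auto simp: fun_eq_iff)
  then obtain j0 where j0: "j0 \<in> J - K" "g j0 \<noteq> 0"
    unfolding g by (metis (no_types, lifting) fun_space.scale_zero_left sum.neutral)
  define L where "L = J - K - {j0}"
  have SL: "fun_space.span (b ` S) \<subseteq> fun_space.span (b ` (S \<union> L))"
    by (intro fun_space.span_mono) auto
  have "fscale (g j0) (b j0) = w - (\<Sum>j\<in>L. fscale (g j) (b j))"
    unfolding g L_def using fin(2) by (simp add: sum.remove[OF _ j0(1)])
  also have "\<dots> \<in> fun_space.span (b ` (S \<union> L))"
    using wS SL
    by (intro fun_space.span_diff fun_space.span_sum fun_space.span_scale)
      (auto intro: fun_space.span_base)
  finally have "fscale (inverse (g j0)) (fscale (g j0) (b j0)) \<in> fun_space.span (b ` (S \<union> L))"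
    by (rule fun_space.span_scale)
  then have bj0: "b j0 \<in> fun_space.span (b ` (S \<union> L))" using j0 by simp
  have "b ` (J - K) \<subseteq> fun_space.span (b ` (S \<union> L))"
  proof
    fix u assume "u \<in> b ` (J - K)"
    then obtain j where "j \<in> J - K" "u = b j" by blast
    then show "u \<in> fun_space.span (b ` (S \<union> L))"
      using bj0 by (cases "j = j0") (auto simp: L_def intro: fun_space.span_base)
  qed
  then have "b ` J \<subseteq> fun_space.span (b ` (S \<union> L))"
    using spJ fun_space.span_minimal[OF _ fun_space.subspace_span] by blast
  then have "fun_space.dim (b ` (S \<union> J)) \<le> fun_space.dim (b ` S) + card L"
    using fin unfolding L_def by (intro fun_space.dim_le_add_card_relative) auto
  moreover have "card L + card K + 1 = card J"
  proof -
    have "card (J - K) > 0" using j0 fin(2) by (metis card_gt_0_iff empty_iff finite_Diff)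
    then have "card L + 1 = card (J - K)"
      unfolding L_def using j0 fin(2) by (simp add: card_Diff_singleton)
    moreover have "card (J - K) + card K = card J"
      using KJ finK fin(2) by (simp add: card_Diff_subset card_mono)
    ultimately show ?thesis by linarith
  qed
  ultimately show ?thesis using dim_a by linarith
qed

text \<open>
  A single index satisfies the inequality, and by the two preceding lemmas a proper subfamily that
  satisfies it extends to a larger one, since \<open>J\<close> raises the right-hand side by at least as much as the
  left-hand side.  So a largest subfamily that satisfies it is the whole family.
\<close>

lemma dim_outer_ge:
  fixes a :: "'i \<Rightarrow> 'x \<Rightarrow> 'a::field" and b :: "'i \<Rightarrow> 'y \<Rightarrow> 'a"
  assumes I: "finite I" "I \<noteq> {}" and ns: "\<not> splits (\<lambda>i. outer (a i) (b i)) I"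
  shows "fun_space.dim (a ` I) + fun_space.dim (b ` I)
    \<le> fun_space.dim ((\<lambda>i. outer (a i) (b i)) ` I) + 1"
proof -
  define z where "z = (\<lambda>i. outer (a i) (b i))"
  define good where "good S \<longleftrightarrow> S \<subseteq> I \<and> S \<noteq> {} \<and>
    fun_space.dim (a ` S) + fun_space.dim (b ` S) \<le> fun_space.dim (z ` S) + 1" for S
  have dim1: "fun_space.dim {f} = (if f = 0 then 0 else 1)" for f :: "'p \<Rightarrow> 'a"
    using fun_space.dim_insert_finite[of "{}" f] fun_space.dim_le_card'[of "{}"] by simp
  obtain i where "i \<in> I" using I by blast
  have "z i \<noteq> 0" if ab: "a i \<noteq> 0" "b i \<noteq> 0"
  proof -
    obtain x where "a i x \<noteq> 0" using ab(1) by (auto simp: fun_eq_iff)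
    moreover obtain y where "b i y \<noteq> 0" using ab(2) by (auto simp: fun_eq_iff)
    ultimately have "z i (x, y) \<noteq> 0" by (simp add: z_def outer_def)
    then show ?thesis by auto
  qed
  then have "good {i}" using \<open>i \<in> I\<close> by (auto simp: good_def dim1)
  moreover have "\<forall>S. good S \<longrightarrow> card S < card I + 1"
    using I card_mono[of I] by (auto simp: good_def less_Suc_eq_le)
  ultimately obtain S where S: "good S" and max: "\<And>S'. good S' \<Longrightarrow> card S' \<le> card S"
    using ex_has_greatest_nat[of good "{i}" card "card I + 1"] by blast
  have finS: "finite S" using S I finite_subset unfolding good_def by blast
  have "S = I"
  proof (rule ccontr)
    assume "S \<noteq> I"
    then have SI: "S \<subset> I" "S \<noteq> {}" using S unfolding good_def by auto
    obtain J c where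
      J: "J \<subseteq> I - S" "J \<noteq> {}" "\<forall>j\<in>J. c j \<noteq> 0"
        "(\<Sum>j\<in>J. fscale (c j) (z j)) \<noteq> 0"
        "(\<Sum>j\<in>J. fscale (c j) (z j)) \<in> fun_space.span (z ` S)"
        "fun_space.dim (z ` S) + card J \<le> fun_space.dim (z ` (S \<union> J)) + 1"
      by (rule minimal_link[OF I(1) SI ns[folded z_def]]) (rule that)
    have finJ: "finite J" using J(1) I finite_subset by blast
    have "fun_space.dim (a ` (S \<union> J)) + fun_space.dim (b ` (S \<union> J)) + 1
      \<le> fun_space.dim (a ` S) + fun_space.dim (b ` S) + card J"
      by (rule linked_factor_dim[OF finS finJ J(3) J(4,5)[unfolded z_def]])
    then have "good (S \<union> J)" using S J unfolding good_def by auto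
    from max[OF this] have "card J \<le> 0"
      using J(1) finS finJ by (subst (asm) card_Un_disjoint) auto
    then show False using J(2) finJ by simp
  qed
  then show ?thesis using S unfolding good_def z_def by simp
qed

text \<open>
  Apply the case of two factors twice, with the outer product of the last two as one factor first.
\<close>

lemma dim_outer3_ge:
  assumes I: "finite I" "I \<noteq> {}" and ns: "\<not> splits (\<lambda>i. outer (a i) (outer (b i) (c i))) I"
  shows "fun_space.dim (a ` I) + fun_space.dim (b ` I) + fun_space.dim (c ` I)
    \<le> fun_space.dim ((\<lambda>i. outer (a i) (outer (b i) (c i))) ` I) + 2"
proof -
  have "\<not> splits (\<lambda>i. outer (b i) (c i)) I"
    using splits_outer[OF I(1)] ns by blast
  from dim_outer_ge[OF I this] dim_outer_ge[OF I ns] show ?thesis by linarith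
qed

section \<open>Uniqueness of sums of outer products\<close>

text \<open>
  Induction on the number of summands on both sides of the identity.  If all of them together
  split, the identity decomposes into two smaller ones.  Otherwise the lower bound on the
  dimension applies, while the identity is a linear relation and bounds the dimension by
  \<open>card P + card Q - 1\<close>.  With the hypothesis for \<open>R = P\<close> this gives \<open>card P < card Q\<close> as soon as
  \<open>card P \<ge> 2\<close>.  Hence \<open>card P = card Q\<close> is possible only if everything splits into identities
  between single summands.
\<close>

lemma kruskal_on_disjoint_sets:
  fixes a :: "'i \<Rightarrow> 'x \<Rightarrow> 'a::field" and b :: "'i \<Rightarrow> 'y \<Rightarrow> 'a" and c :: "'i \<Rightarrow> 'w \<Rightarrow> 'a"
  defines "z \<equiv> \<lambda>i. outer (a i) (outer (b i) (c i))"
  assumes "finite P" "finite Q" "P \<inter> Q = {}"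
    and "(\<Sum>i\<in>P. z i) = (\<Sum>i\<in>Q. z i)" and "\<forall>i\<in>P. z i \<noteq> 0"
    and "\<forall>R\<subseteq>P. 2 \<le> card R \<longrightarrow> 2 * card R + 2 \<le>
      fun_space.dim (a ` R) + fun_space.dim (b ` R) + fun_space.dim (c ` R)"
  shows "card P \<le> card Q \<and>
    (card P = card Q \<longrightarrow> image_mset z (mset_set P) = image_mset z (mset_set Q))"
  using assms(2-)
proof (induction "card (P \<union> Q)" arbitrary: P Q rule: less_induct)
  case less
  note finP = \<open>finite P\<close> and finQ = \<open>finite Q\<close> and disj = \<open>P \<inter> Q = {}\<close>
    and eq = less.prems(4) and nz = less.prems(5) and kr = less.prems(6)
  let ?I = "P \<union> Q"
  have finI: "finite ?I" using finP finQ by simp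
  show ?case
  proof (cases "P = {}")
    case True
    then show ?thesis using finQ by auto
  next
    case False
    show ?thesis
    proof (cases "splits z ?I")
      case True
      then obtain S where S: "S \<subset> ?I" "S \<noteq> {}"
        "fun_space.span (z ` S) \<inter> fun_space.span (z ` (?I - S)) \<subseteq> {0}"
        unfolding splits_def by blast
      \<comment> \<open>\<open>D1\<close> and \<open>D2\<close> are the two parts of the relation; they are equal and lie in independent
        spans.\<close>
      define D1 where "D1 = (\<Sum>i\<in>P \<inter> S. z i) - (\<Sum>i\<in>Q \<inter> S. z i)"
      define D2 where "D2 = (\<Sum>i\<in>Q - S. z i) - (\<Sum>i\<in>P - S. z i)"
      have in1: "D1 \<in> fun_space.span (z ` S)" unfolding D1_def
        by (intro fun_space.span_diff fun_space.span_sum fun_space.span_base) auto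
      have in2: "D2 \<in> fun_space.span (z ` (?I - S))" unfolding D2_def
        by (intro fun_space.span_diff fun_space.span_sum fun_space.span_base) auto
      have "(\<Sum>i\<in>P. z i) = (\<Sum>i\<in>P \<inter> S. z i) + (\<Sum>i\<in>P - S. z i)"
        "(\<Sum>i\<in>Q. z i) = (\<Sum>i\<in>Q \<inter> S. z i) + (\<Sum>i\<in>Q - S. z i)"
        using finP finQ by (simp_all add: sum.Int_Diff)
      with eq have "(\<Sum>i\<in>P \<inter> S. z i) + (\<Sum>i\<in>P - S. z i) = (\<Sum>i\<in>Q \<inter> S. z i) + (\<Sum>i\<in>Q - S. z i)"
        by simp
      then have "D1 = D2" unfolding D1_def D2_def
        by (simp add: algebra_simps)
      with in1 in2 S(3) have "D1 = 0" "D2 = 0" by auto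
      then have eq1: "(\<Sum>i\<in>P \<inter> S. z i) = (\<Sum>i\<in>Q \<inter> S. z i)"
        and eq2: "(\<Sum>i\<in>P - S. z i) = (\<Sum>i\<in>Q - S. z i)"
        unfolding D1_def D2_def by simp_all
      have "card ((P \<inter> S) \<union> (Q \<inter> S)) < card ?I"
        using S(1) finI by (intro psubset_card_mono) auto
      then have 1: "card (P \<inter> S) \<le> card (Q \<inter> S) \<and> (card (P \<inter> S) = card (Q \<inter> S) \<longrightarrow>
          image_mset z (mset_set (P \<inter> S)) = image_mset z (mset_set (Q \<inter> S)))"
        by (rule less.hyps) (use finP finQ disj nz eq1 kr in auto)
      have "card ((P - S) \<union> (Q - S)) < card ?I"
        using S(1,2) finI by (intro psubset_card_mono) auto
      then have 2: "card (P - S) \<le> card (Q - S) \<and> (card (P - S) = card (Q - S) \<longrightarrow>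
          image_mset z (mset_set (P - S)) = image_mset z (mset_set (Q - S)))"
        by (rule less.hyps) (use finP finQ disj nz eq2 kr in auto)
      have parts: "card X = card (X \<inter> S) + card (X - S)"
        "mset_set X = mset_set (X \<inter> S) + mset_set (X - S)" if "finite X" for X
      proof -
        have "X = (X \<inter> S) \<union> (X - S)" by blast
        moreover have "card ((X \<inter> S) \<union> (X - S)) = card (X \<inter> S) + card (X - S)"
          using that by (intro card_Un_disjoint) auto
        moreover have "mset_set ((X \<inter> S) \<union> (X - S)) = mset_set (X \<inter> S) + mset_set (X - S)"
          using that by (intro mset_set_Union) auto
        ultimately show "card X = card (X \<inter> S) + card (X - S)"
          "mset_set X = mset_set (X \<inter> S) + mset_set (X - S)" by simp_all
      qed
      show ?thesis
      proof (intro conjI impI)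
        show "card P \<le> card Q" using 1 2 parts(1)[OF finP] parts(1)[OF finQ] by linarith
        assume "card P = card Q"
        then have "card (P \<inter> S) = card (Q \<inter> S)" "card (P - S) = card (Q - S)"
          using 1 2 parts(1)[OF finP] parts(1)[OF finQ] by linarith+
        then show "image_mset z (mset_set P) = image_mset z (mset_set Q)"
          using 1 2 by (simp add: parts(2)[OF finP] parts(2)[OF finQ])
      qed
    next
      case nonsplit: False
      obtain p where p: "p \<in> P" using False by blast
      show ?thesis
      proof (cases "card P \<ge> 2")
        case True
        have "z p = (\<Sum>i\<in>Q. z i) - (\<Sum>i\<in>P - {p}. z i)"
          using eq sum.remove[OF finP p, of z] by (simp add: algebra_simps)
        also have "\<dots> \<in> fun_space.span (z ` (?I - {p}))"
          using p disj by (intro fun_space.span_diff fun_space.span_sum fun_space.span_base) auto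
        finally have "fun_space.dim (insert (z p) (z ` (?I - {p}))) = fun_space.dim (z ` (?I - {p}))"
          using finI by (simp add: fun_space.dim_insert_finite)
        moreover have "insert (z p) (z ` (?I - {p})) = z ` ?I" using p by blast
        ultimately have "fun_space.dim (z ` ?I) = fun_space.dim (z ` (?I - {p}))" by simp
        also have "\<dots> \<le> card (z ` (?I - {p}))"
          using finI by (intro fun_space.dim_le_card') simp
        also have "\<dots> \<le> card (?I - {p})" using finI by (intro card_image_le) simp
        also have "\<dots> = card ?I - 1" using p by (simp add: card_Diff_singleton)
        also have "card ?I = card P + card Q" using finP finQ disj by (rule card_Un_disjoint)
        finally have up: "fun_space.dim (z ` ?I) \<le> card P + card Q - 1" .
        have "fun_space.dim (a ` ?I) + fun_space.dim (b ` ?I) + fun_space.dim (c ` ?I)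
          \<le> fun_space.dim (z ` ?I) + 2"
          unfolding z_def by (rule dim_outer3_ge[OF finI _ nonsplit[unfolded z_def]]) (use p in blast)
        moreover have "fun_space.dim (a ` P) \<le> fun_space.dim (a ` ?I)"
          "fun_space.dim (b ` P) \<le> fun_space.dim (b ` ?I)"
          "fun_space.dim (c ` P) \<le> fun_space.dim (c ` ?I)"
          using finI by (auto intro!: fun_space.dim_mono_finite)
        moreover have "2 * card P + 2 \<le>
          fun_space.dim (a ` P) + fun_space.dim (b ` P) + fun_space.dim (c ` P)"
          using kr True by blast
        ultimately have "card P < card Q" using up True by linarith
        then show ?thesis by simp
      next
        case small: False
        have "card P \<noteq> 0" using p finP by auto
        with small have "card P = 1" by linarith
        with p have P: "P = {p}" by (metis card_1_singletonE singletonD)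
        then have zp: "z p = (\<Sum>i\<in>Q. z i)" using eq by simp
        then have "Q \<noteq> {}" using nz p by auto
        then have "card Q \<noteq> 0" using finQ by simp
        then show ?thesis
        proof (intro conjI impI)
          assume "card P = card Q"
          then have "card Q = 1" using P by simp
          then obtain q where "Q = {q}" by (rule card_1_singletonE)
          then show "image_mset z (mset_set P) = image_mset z (mset_set Q)" using zp P by simp
        qed (simp add: P)
      qed
    qed
  qed
qed

text \<open>
  Kruskal's theorem for three factors.  The hypothesis is the dimension bound that Kruskal's
  inequality on the \<open>k\<close>-ranks yields for every subfamily of at least two summands.
  Indexing both decompositions by a sum type reduces it to disjoint index sets.
\<close>

theorem kruskal:
  fixes a :: "'i \<Rightarrow> 'x \<Rightarrow> 'a::field" and b :: "'i \<Rightarrow> 'y \<Rightarrow> 'a" and c :: "'i \<Rightarrow> 'w \<Rightarrow> 'a"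
    and a' :: "'j \<Rightarrow> 'x \<Rightarrow> 'a" and b' :: "'j \<Rightarrow> 'y \<Rightarrow> 'a" and c' :: "'j \<Rightarrow> 'w \<Rightarrow> 'a"
  defines "z \<equiv> \<lambda>i. outer (a i) (outer (b i) (c i))"
    and "z' \<equiv> \<lambda>j. outer (a' j) (outer (b' j) (c' j))"
  assumes fin: "finite P" "finite Q"
    and eq: "(\<Sum>i\<in>P. z i) = (\<Sum>j\<in>Q. z' j)" and nz: "\<forall>i\<in>P. z i \<noteq> 0"
    and kr: "\<And>R. R \<subseteq> P \<Longrightarrow> 2 \<le> card R \<Longrightarrow> 2 * card R + 2 \<le>
      fun_space.dim (a ` R) + fun_space.dim (b ` R) + fun_space.dim (c ` R)"
  shows "card P \<le> card Q"
    and "card P = card Q \<Longrightarrow> image_mset z (mset_set P) = image_mset z' (mset_set Q)"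
proof -
  define u where "u = (\<lambda>k. outer (case_sum a a' k) (outer (case_sum b b' k) (case_sum c c' k)))"
  have u: "u (Inl i) = z i" "u (Inr j) = z' j" for i j
    by (simp_all add: u_def z_def z'_def)
  let ?P = "Inl ` P :: ('i + 'j) set" and ?Q = "Inr ` Q :: ('i + 'j) set"
  have sums: "(\<Sum>k\<in>?P. u k) = (\<Sum>k\<in>?Q. u k)"
    using eq by (simp add: sum.reindex u)
  have nzu: "\<forall>k\<in>?P. u k \<noteq> 0" using nz by (auto simp: u)
  have kru: "\<forall>R\<subseteq>?P. 2 \<le> card R \<longrightarrow> 2 * card R + 2 \<le>
      fun_space.dim (case_sum a a' ` R) + fun_space.dim (case_sum b b' ` R)
      + fun_space.dim (case_sum c c' ` R)"
  proof (intro allI impI)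
    fix R assume "R \<subseteq> ?P" and card: "2 \<le> card R"
    then obtain R' where R': "R' \<subseteq> P" "R = Inl ` R'" by (meson subset_imageE)
    then have "card R = card R'" by (simp add: card_image)
    then show "2 * card R + 2 \<le> fun_space.dim (case_sum a a' ` R)
      + fun_space.dim (case_sum b b' ` R) + fun_space.dim (case_sum c c' ` R)"
      using kr[OF R'(1)] card R'(2) by (simp add: image_image)
  qed
  have "card ?P \<le> card ?Q \<and>
    (card ?P = card ?Q \<longrightarrow> image_mset u (mset_set ?P) = image_mset u (mset_set ?Q))"
    by (rule kruskal_on_disjoint_sets[where a = "case_sum a a'" and b = "case_sum b b'"
          and c = "case_sum c c'" and P = ?P and Q = ?Q, folded u_def,
          OF _ _ _ sums nzu[unfolded u_def] kru])
      (use fin in auto)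
  then have *: "card P \<le> card Q \<and> (card P = card Q \<longrightarrow>
    image_mset u (image_mset Inl (mset_set P)) = image_mset u (image_mset Inr (mset_set Q)))"
    by (simp add: card_image image_mset_mset_set)
  then show "card P \<le> card Q" by blast
  show "image_mset z (mset_set P) = image_mset z' (mset_set Q)" if "card P = card Q"
    using * that by (simp add: image_mset.compositionality comp_def u)
qed

section \<open>Tensors and their regrouping into three modes\<close>

lemma tscale_eq_fscale: "tscale = fscale"
  by (simp add: tscale_def fscale_def fun_eq_iff)

lemma dim_ge_of_any_independent:
  assumes ind: "any_independent k r v" and k: "k \<le> r" and R: "R \<subseteq> {1..r}"
  shows "min k (card R) \<le> fun_space.dim (v ` R)"
proof -
  obtain R' where R': "R' \<subseteq> R" "card R' = min k (card R)"
    using obtain_subset_with_card_n[of "min k (card R)" R] by auto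
  have "finite R" using R finite_subset by blast
  obtain J where J: "R' \<subseteq> J" "J \<subseteq> {1..r}" "card J = k"
    using exists_subset_between[of R' k "{1..r}"] R R' k by auto
  then have "inj_on v J" "fun_space.independent (v ` J)"
    using ind unfolding any_independent_def tscale_eq_fscale by auto
  then have "inj_on v R'" "fun_space.independent (v ` R')"
    using inj_on_subset[of v J] fun_space.independent_mono[OF _ image_mono] J(1) by blast+
  then have "fun_space.dim (v ` R') = card R'"
    by (simp add: fun_space.dim_eq_card_independent card_image)
  moreover have "fun_space.dim (v ` R') \<le> fun_space.dim (v ` R)"
    using \<open>finite R\<close> R'(1) by (intro fun_space.dim_mono_finite) auto
  ultimately show ?thesis using R'(2) by simp
qed

lemma dim_image_fscale:
  assumes "\<And>j. j \<in> R \<Longrightarrow> t j \<noteq> 0"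
  shows "fun_space.dim ((\<lambda>j. fscale (t j) (v j)) ` R) = fun_space.dim (v ` R)"
proof (rule fun_space.span_eq_dim)
  have "v j \<in> fun_space.span ((\<lambda>j. fscale (t j) (v j)) ` R)" if "j \<in> R" for j
  proof -
    have "fscale (inverse (t j)) (fscale (t j) (v j)) \<in> fun_space.span ((\<lambda>j. fscale (t j) (v j)) ` R)"
      using that by (intro fun_space.span_scale fun_space.span_base) auto
    then show ?thesis using assms[OF that] by simp
  qed
  then show "fun_space.span ((\<lambda>j. fscale (t j) (v j)) ` R) = fun_space.span (v ` R)"
    unfolding fun_space.span_eq by (auto intro!: fun_space.span_scale intro: fun_space.span_base)
qed

lemma tensor_product_Nil: "tensor_product [] x = (if x = [] then 1 else 0)"
  by (simp add: tensor_product_def)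

lemma tensor_product_Cons: "tensor_product (v # vs) (i # x) = v $ i * tensor_product vs x"
  by (simp add: tensor_product_def prod.lessThan_Suc_shift del: prod.lessThan_Suc)

lemma tensor_product_eq_0: "length x \<noteq> length vs \<Longrightarrow> tensor_product vs x = 0"
  by (simp add: tensor_product_def)

lemma tensor_product_append:
  assumes "length x = length us"
  shows "tensor_product (us @ vs) (x @ y) = tensor_product us x * tensor_product vs y"
  using assms
  by (induction x us rule: list_induct2)
    (simp_all add: tensor_product_Nil tensor_product_Cons)

lemma tensor_product_nonzero:
  assumes "0 \<notin> set vs"
  shows "tensor_product vs \<noteq> 0"
proof -
  have "\<exists>x. tensor_product vs x \<noteq> 0"
    using assms
  proof (induction vs)
    case Nil
    show ?case by (rule exI[of _ "[]"]) (simp add: tensor_product_Nil)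
  next
    case (Cons v vs)
    then obtain x where "tensor_product vs x \<noteq> 0" by auto
    moreover obtain i where "v $ i \<noteq> 0" using Cons.prems by (auto simp: vec_eq_iff)
    ultimately have "tensor_product (v # vs) (i # x) \<noteq> 0" by (simp add: tensor_product_Cons)
    then show ?case by blast
  qed
  then show ?thesis by auto
qed

lemma tensor_product_scale_Cons:
  "tensor_product (c *s v # vs) = tscale c (tensor_product (v # vs))"
proof
  fix x show "tensor_product (c *s v # vs) x = tscale c (tensor_product (v # vs)) x"
    by (cases x)
      (simp_all add: tensor_product_Cons tscale_def tensor_product_eq_0 mult.assoc)
qed

text \<open>
  A tensor as an array with three modes.  The guard on the lengths makes a product of vectors an
  outer product everywhere, also where the pieces of the index list have the wrong lengths.
\<close>

definition regroup ::
    "nat \<Rightarrow> nat \<Rightarrow> ('a::field, 'm::finite) tensor \<Rightarrow> 'm list \<times> 'm list \<times> 'm list \<Rightarrow> 'a" where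
  "regroup p q T = (\<lambda>(x, y, w). if length x = p \<and> length y = q then T (x @ y @ w) else 0)"

lemma regroup_tensor_product:
  assumes "length us = p" "length vs = q"
  shows "regroup p q (tensor_product (us @ vs @ ws)) =
    outer (tensor_product us) (outer (tensor_product vs) (tensor_product ws))"
  using assms
  by (auto simp: fun_eq_iff regroup_def outer_def tensor_product_append tensor_product_eq_0)

lemma regroup_sum: "regroup p q (\<Sum>j\<in>J. f j) = (\<Sum>j\<in>J. regroup p q (f j))"
  by (auto simp: fun_eq_iff regroup_def sum_fun_apply)

lemma regroup_inj_on_tensors:
  assumes "p + q \<le> d"
  shows "inj_on (regroup p q) (tensors d)"
proof (rule inj_onI)
  fix T T'
  assume T: "T \<in> tensors d" "T' \<in> tensors d" and eq: "regroup p q T = regroup p q T'"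
  show "T = T'"
  proof
    fix x
    show "T x = T' x"
    proof (cases "length x = d")
      case True
      have len: "length (take p x) = p" "length (take q (drop p x)) = q"
        using assms True by auto
      have "regroup p q U (take p x, take q (drop p x), drop q (drop p x)) = U x" for U
        by (simp only: regroup_def prod.case len append_take_drop_id simp_thms if_True)
      then show ?thesis using eq by metis
    next
      case False
      then show ?thesis using T by (simp add: tensors_def)
    qed
  qed
qed

lemma rank_one_tensor_in_tensors: "A \<in> rank_one_tensors d \<Longrightarrow> A \<in> tensors d"
  by (auto simp: rank_one_tensors_def tensors_def tensor_product_eq_0)

lemma tensor_segment_split:
  assumes "d = 1 + b + c"
  shows "tensor_segment x 1 d j = tensor_product
    (map (\<lambda>i. x i j) [1..<2] @ map (\<lambda>i. x i j) [2..<b + 2] @ map (\<lambda>i. x i j) [b + 2..<Suc d])"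
proof -
  have "[1..<Suc d] = [1..<2] @ [2..<Suc d]" using upt_add_eq_append[of 1 2 "b + c"] assms by simp
  also have "[2..<Suc d] = [2..<b + 2] @ [b + 2..<Suc d]"
    using upt_add_eq_append[of 2 "b + 2" c] assms by (simp add: add.commute)
  finally show ?thesis unfolding tensor_segment_def by simp
qed

lemma rank_one_tensor_segment:
  assumes "decomposition d r x T" "j \<in> {1..r}"
  shows "tensor_segment x 1 d j \<in> rank_one_tensors d"
  using assms unfolding decomposition_def tensor_segment_def rank_one_tensors_def
  by (auto intro!: exI[of _ "map (\<lambda>i. x i j) [1..<Suc d]"] simp del: upt_Suc)

lemma decomposition_imp_rank_one_sum:
  assumes "decomposition d r x T"
  shows "rank_one_sum d r (tensor_segment x 1 d) T"
  using rank_one_tensor_segment[OF assms] assms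
  unfolding rank_one_sum_def decomposition_def by blast

section \<open>Kruskal's condition for tensors\<close>

text \<open>
  Kruskal's inequality on the \<open>k\<close>-ranks of the factors, grouped into modes of orders \<open>1\<close>, \<open>b\<close>,
  \<open>c\<close>, enters only through these bounds for subfamilies.  They ask nothing of a decomposition with
  one summand, which the inequality \<open>k\<^sub>1 + k\<^sub>2 + k\<^sub>3 \<ge> 2 r + 2\<close> would exclude.
\<close>

definition kruskal_condition ::
    "nat \<Rightarrow> nat \<Rightarrow> nat \<Rightarrow> (nat \<Rightarrow> nat \<Rightarrow> 'a::field ^ 'm::finite) \<Rightarrow> bool" where
  "kruskal_condition b c r x \<longleftrightarrow> (\<forall>R\<subseteq>{1..r}. 2 \<le> card R \<longrightarrow> 2 * card R + 2 \<le>
     fun_space.dim (tensor_segment x 1 1 ` R) + fun_space.dim (tensor_segment x 2 (b + 1) ` R)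
     + fun_space.dim (tensor_segment x (b + 2) (1 + b + c) ` R))"

text \<open>
  Regrouping into modes of orders \<open>1\<close>, \<open>b\<close>, \<open>c\<close> turns rank one tensors of order \<open>d\<close> into
  outer products of three functions and is injective, so Kruskal's theorem carries over to any
  competing sum of rank one tensors.
\<close>

lemma rank_one_sum_unique:
  assumes dec: "decomposition d r x T" and d: "d = 1 + b + c"
    and kr: "kruskal_condition b c r x" and B: "rank_one_sum d r' B T"
  shows "r \<le> r'"
    and "r = r' \<Longrightarrow> image_mset (tensor_segment x 1 d) (mset_set {1..r}) =
           image_mset B (mset_set {1..r'})"
proof -
  have "\<exists>vs. \<forall>j\<in>{1..r'}. B j = tensor_product (vs j) \<and> length (vs j) = d"
    using B unfolding rank_one_sum_def rank_one_tensors_def by (intro bchoice) auto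
  then obtain vs where vs: "\<And>j. j \<in> {1..r'} \<Longrightarrow> B j = tensor_product (vs j)"
    "\<And>j. j \<in> {1..r'} \<Longrightarrow> length (vs j) = d" by blast
  define y1 where "y1 j = tensor_product (take 1 (vs j))" for j
  define y2 where "y2 j = tensor_product (take b (drop 1 (vs j)))" for j
  define y3 where "y3 j = tensor_product (drop b (drop 1 (vs j)))" for j
  let ?z = "\<lambda>j. outer (tensor_segment x 1 1 j) (outer (tensor_segment x 2 (b + 1) j)
    (tensor_segment x (b + 2) (1 + b + c) j))"
  let ?y = "\<lambda>j. outer (y1 j) (outer (y2 j) (y3 j))"
  have z: "regroup 1 b (tensor_segment x 1 d j) = ?z j" for j
    unfolding tensor_segment_split[OF d]
    by (subst regroup_tensor_product) (simp_all add: tensor_segment_def d numeral_2_eq_2 del: upt_Suc)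
  have y: "regroup 1 b (B j) = ?y j" if "j \<in> {1..r'}" for j
  proof -
    have "regroup 1 b (tensor_product (take 1 (vs j) @ take b (drop 1 (vs j)) @ drop b (drop 1 (vs j))))
      = ?y j"
      unfolding y1_def y2_def y3_def using vs(2)[OF that] d
      by (intro regroup_tensor_product) auto
    then show ?thesis using vs(1)[OF that] by (simp only: append_take_drop_id)
  qed
  have "T = (\<Sum>j=1..r. tensor_segment x 1 d j)" "T = (\<Sum>j=1..r'. B j)"
    using dec B unfolding decomposition_def rank_one_sum_def by blast+
  then have "regroup 1 b (\<Sum>j=1..r. tensor_segment x 1 d j) = regroup 1 b (\<Sum>j=1..r'. B j)" by simp
  then have eq: "(\<Sum>j\<in>{1..r}. ?z j) = (\<Sum>j\<in>{1..r'}. ?y j)"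
    unfolding regroup_sum z using y by simp
  have nz: "\<forall>j\<in>{1..r}. ?z j \<noteq> 0"
  proof
    fix j assume j: "j \<in> {1..r}"
    obtain us where "tensor_segment x 1 d j = tensor_product us" "0 \<notin> set us"
      using rank_one_tensor_segment[OF dec j] unfolding rank_one_tensors_def by blast
    then have ne: "tensor_segment x 1 d j \<noteq> 0" using tensor_product_nonzero by simp
    show "?z j \<noteq> 0"
    proof
      assume "?z j = 0"
      then have "regroup 1 b (tensor_segment x 1 d j) = regroup 1 b 0"
        using z by (simp add: regroup_def fun_eq_iff)
      moreover have "tensor_segment x 1 d j \<in> tensors d" "0 \<in> tensors d"
        using rank_one_tensor_in_tensors[OF rank_one_tensor_segment[OF dec j]]
        by (auto simp: tensors_def)
      ultimately show False
        using regroup_inj_on_tensors[of 1 b d] ne d by (auto dest: inj_onD)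
    qed
  qed
  have kr': "2 * card R + 2 \<le> fun_space.dim (tensor_segment x 1 1 ` R)
      + fun_space.dim (tensor_segment x 2 (b + 1) ` R)
      + fun_space.dim (tensor_segment x (b + 2) (1 + b + c) ` R)"
    if "R \<subseteq> {1..r}" "2 \<le> card R" for R
    using kr that unfolding kruskal_condition_def by blast
  note K = kruskal[OF finite_atLeastAtMost finite_atLeastAtMost eq nz kr']
  from K(1) show "r \<le> r'" by simp
  show "image_mset (tensor_segment x 1 d) (mset_set {1..r}) = image_mset B (mset_set {1..r'})"
    if "r = r'"
  proof (rule multiset.inj_map_strong[of _ _ "regroup 1 b" "regroup 1 b"])
    fix A A'
    assume "A \<in># image_mset (tensor_segment x 1 d) (mset_set {1..r})"
      "A' \<in># image_mset B (mset_set {1..r'})" "regroup 1 b A = regroup 1 b A'"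
    moreover from this obtain j j' where "j \<in> {1..r}" "A = tensor_segment x 1 d j"
      "j' \<in> {1..r'}" "A' = B j'"
      by auto
    then have "A \<in> tensors d" "A' \<in> tensors d"
      using B rank_one_tensor_segment[OF dec] rank_one_tensor_in_tensors
      unfolding rank_one_sum_def by blast+
    ultimately show "A = A'"
      using regroup_inj_on_tensors[of 1 b d] d by (auto dest: inj_onD)
  next
    have "image_mset ?z (mset_set {1..r}) = image_mset ?y (mset_set {1..r'})"
      using K(2) that by simp
    also have "\<dots> = image_mset (\<lambda>j. regroup 1 b (B j)) (mset_set {1..r'})"
      using y by (intro image_mset_cong) simp
    finally show "image_mset (regroup 1 b) (image_mset (tensor_segment x 1 d) (mset_set {1..r})) =
      image_mset (regroup 1 b) (image_mset B (mset_set {1..r'}))"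
      by (simp add: image_mset.compositionality comp_def z del: One_nat_def)
  qed
qed

lemma kruskal_condition_imp_rank:
  assumes dec: "decomposition d r x T" and d: "d = 1 + b + c" and kr: "kruskal_condition b c r x"
  shows "tensor_rank d T = r"
  unfolding tensor_rank_def
proof (rule Least_equality)
  show "\<exists>x. decomposition d r x T" using dec by blast
  show "r \<le> r'" if "\<exists>x. decomposition d r' x T" for r'
    using that rank_one_sum_unique(1)[OF dec d kr] decomposition_imp_rank_one_sum by blast
qed

lemma kruskal_condition_imp_unique:
  assumes dec: "decomposition d r x T" and d: "d = 1 + b + c" and kr: "kruskal_condition b c r x"
  shows "unique_rank_one_sum d r T"
  unfolding unique_rank_one_sum_def
proof (intro conjI allI impI)
  show "\<exists>A. rank_one_sum d r A T" using decomposition_imp_rank_one_sum[OF dec] by blast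
  fix A B assume AB: "rank_one_sum d r A T \<and> rank_one_sum d r B T"
  then have "image_mset B (mset_set {1..r}) = image_mset A (mset_set {1..r})"
    using rank_one_sum_unique(2)[OF dec d kr, of r] by metis
  then show "\<exists>\<pi>. \<pi> permutes {1..r} \<and> (\<forall>j\<in>{1..r}. B j = A (\<pi> j))"
    by (rule image_mset_eq_implies_permutes[OF finite_atLeastAtMost]) blast
qed

section \<open>Generic decompositions satisfy Kruskal's condition\<close>

text \<open>
  The two inequalities compare \<open>2 p + 2\<close> with the dimensions that genericity guarantees for the
  factors of \<open>p\<close> summands.  Here \<open>m\<close>, \<open>N\<close>, \<open>M\<close> are the dimensions of the spaces of factors: \<open>N\<close>
  occurs twice in odd order, and in even order \<open>r \<le> M\<close> follows from the last two hypotheses.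
  For \<open>p \<le> N\<close> the last two terms are \<open>p\<close> and the first is at least \<open>2\<close>; for larger \<open>p\<close> the
  bound on \<open>r\<close> is what is needed.
\<close>

lemma kruskal_inequality_odd:
  fixes m N p r :: nat
  assumes "2 \<le> m" "m \<le> N" "2 \<le> p" "p \<le> r" "2 * r + 2 \<le> 2 * N + m"
  shows "2 * p + 2 \<le> min (min m r) p + min (min N r) p + min (min N r) p"
  using assms by (auto simp: min_def)

lemma kruskal_inequality_even:
  fixes m N M p r :: nat
  assumes "2 \<le> m" "m \<le> N" "2 \<le> p" "p \<le> r" "r + 2 \<le> N + m" "N + m \<le> M + 2"
  shows "2 * p + 2 \<le> min (min m r) p + min (min N r) p + min (min M r) p"
  using assms by (auto simp: min_def)

lemma kruskal_condition_of_any_independent: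
  assumes ind: "any_independent (min k\<^sub>1 r) r (tensor_segment x 1 1)"
      "any_independent (min k\<^sub>2 r) r (tensor_segment x 2 (b + 1))"
      "any_independent (min k\<^sub>3 r) r (tensor_segment x (b + 2) (1 + b + c))"
    and ineq: "\<And>p. 2 \<le> p \<Longrightarrow> p \<le> r \<Longrightarrow>
      2 * p + 2 \<le> min (min k\<^sub>1 r) p + min (min k\<^sub>2 r) p + min (min k\<^sub>3 r) p"
  shows "kruskal_condition b c r x"
  unfolding kruskal_condition_def
proof (intro allI impI)
  fix R assume R: "R \<subseteq> {1..r}" "2 \<le> card R"
  then have "card R \<le> r" using card_mono[of "{1..r}" R] by simp
  from ineq[OF R(2) this] dim_ge_of_any_independent[OF ind(1) _ R(1)]
    dim_ge_of_any_independent[OF ind(2) _ R(1)] dim_ge_of_any_independent[OF ind(3) _ R(1)]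
  show "2 * card R + 2 \<le> fun_space.dim (tensor_segment x 1 1 ` R)
      + fun_space.dim (tensor_segment x 2 (b + 1) ` R)
      + fun_space.dim (tensor_segment x (b + 2) (1 + b + c) ` R)"
    by simp
qed

text \<open>
  The decomposition of a symmetric tensor as an ordinary one, in which the coefficient is moved
  into the factor of the first mode.
\<close>

definition absorb_coefficients ::
    "(nat \<Rightarrow> 'a) \<Rightarrow> (nat \<Rightarrow> 'a::field ^ 'm::finite) \<Rightarrow> nat \<Rightarrow> nat \<Rightarrow> 'a ^ 'm" where
  "absorb_coefficients t u i j = (if i = 1 then t j *s u j else u j)"

lemma tensor_segment_absorb_coefficients_first:
  assumes "1 \<le> d"
  shows "tensor_segment (absorb_coefficients t u) 1 d j = tscale (t j) (tensor_power d (u j))"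
proof -
  have "map (\<lambda>i. absorb_coefficients t u i j) [1..<Suc d] = t j *s u j # replicate (d - 1) (u j)"
  proof (rule nth_equalityI)
    fix i assume "i < length (map (\<lambda>i. absorb_coefficients t u i j) [1..<Suc d])"
    then show "map (\<lambda>i. absorb_coefficients t u i j) [1..<Suc d] ! i =
        (t j *s u j # replicate (d - 1) (u j)) ! i"
      by (cases i) (simp_all add: absorb_coefficients_def del: upt_Suc)
  qed (use assms in simp)
  moreover have "replicate d (u j) = u j # replicate (d - 1) (u j)"
    using assms by (cases d) simp_all
  ultimately show ?thesis
    unfolding tensor_segment_def tensor_power_def by (simp only: tensor_product_scale_Cons)
qed

lemma tensor_segment_absorb_coefficients:
  assumes "2 \<le> l"
  shows "tensor_segment (absorb_coefficients t u) l h j = tensor_power (Suc h - l) (u j)"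
proof -
  have "map (\<lambda>i. absorb_coefficients t u i j) [l..<Suc h] = replicate (Suc h - l) (u j)"
    using assms by (intro nth_equalityI) (simp_all add: absorb_coefficients_def del: upt_Suc)
  then show ?thesis unfolding tensor_segment_def tensor_power_def by simp
qed

lemma decomposition_absorb_coefficients:
  assumes "symmetric_decomposition d s t u S" "1 \<le> d"
  shows "decomposition d s (absorb_coefficients t u) S"
  using assms tensor_segment_absorb_coefficients_first[OF assms(2), of t u]
  unfolding symmetric_decomposition_def decomposition_def
  by (auto simp: absorb_coefficients_def)

text \<open>
  The coefficients are nonzero, so moving them into the first factor does not change the dimensions.
\<close>

lemma symmetric_kruskal_condition:
  assumes dec: "symmetric_decomposition d s t u S"
    and ind: "any_independent (min k\<^sub>1 s) s (\<lambda>j. tensor_power 1 (u j))"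
      "any_independent (min k\<^sub>2 s) s (\<lambda>j. tensor_power b (u j))"
      "any_independent (min k\<^sub>3 s) s (\<lambda>j. tensor_power c (u j))"
    and ineq: "\<And>p. 2 \<le> p \<Longrightarrow> p \<le> s \<Longrightarrow>
      2 * p + 2 \<le> min (min k\<^sub>1 s) p + min (min k\<^sub>2 s) p + min (min k\<^sub>3 s) p"
  shows "kruskal_condition b c s (absorb_coefficients t u)"
  unfolding kruskal_condition_def
proof (intro allI impI)
  fix R assume R: "R \<subseteq> {1..s}" "2 \<le> card R"
  then have "card R \<le> s" using card_mono[of "{1..s}" R] by simp
  have seg1: "tensor_segment (absorb_coefficients t u) 1 1
      = (\<lambda>j. fscale (t j) (tensor_power 1 (u j)))"
    using tensor_segment_absorb_coefficients_first[of 1 t u]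
    by (simp add: fun_eq_iff tscale_eq_fscale)
  have "t j \<noteq> 0" if "j \<in> R" for j
    using dec R(1) that unfolding symmetric_decomposition_def by blast
  then have dim1: "fun_space.dim (tensor_segment (absorb_coefficients t u) 1 1 ` R)
      = fun_space.dim ((\<lambda>j. tensor_power 1 (u j)) ` R)"
    unfolding seg1 by (rule dim_image_fscale)
  have seg: "tensor_segment (absorb_coefficients t u) 2 (b + 1) = (\<lambda>j. tensor_power b (u j))"
    "tensor_segment (absorb_coefficients t u) (b + 2) (1 + b + c) = (\<lambda>j. tensor_power c (u j))"
    by (simp_all add: fun_eq_iff tensor_segment_absorb_coefficients)
  from ineq[OF R(2) \<open>card R \<le> s\<close>] dim_ge_of_any_independent[OF ind(1) _ R(1)]
    dim_ge_of_any_independent[OF ind(2) _ R(1)] dim_ge_of_any_independent[OF ind(3) _ R(1)]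
  show "2 * card R + 2 \<le> fun_space.dim (tensor_segment (absorb_coefficients t u) 1 1 ` R)
      + fun_space.dim (tensor_segment (absorb_coefficients t u) 2 (b + 1) ` R)
      + fun_space.dim (tensor_segment (absorb_coefficients t u) (b + 2) (1 + b + c) ` R)"
    unfolding dim1 seg by simp
qed

text \<open>
  A symmetric decomposition is also an ordinary one, so it cannot have fewer summands than the rank.
\<close>

lemma symmetric_rank_eq:
  assumes dec: "symmetric_decomposition d s t u S" and d: "d = 1 + b + c"
    and kr: "kruskal_condition b c s (absorb_coefficients t u)"
  shows "symmetric_rank d S = s"
  unfolding symmetric_rank_def
proof (rule Least_equality)
  show "\<exists>t u. symmetric_decomposition d s t u S" using dec by blast
  have d1: "1 \<le> d" using d by simp
  show "s \<le> s'" if "\<exists>t u. symmetric_decomposition d s' t u S" for s'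
    using that rank_one_sum_unique(1)[OF decomposition_absorb_coefficients[OF dec d1] d kr]
      decomposition_absorb_coefficients[OF _ d1] decomposition_imp_rank_one_sum by blast
qed

lemma le_choose_add_sub:
  fixes m b :: nat
  assumes "1 \<le> m" "1 \<le> b"
  shows "m \<le> (m + b - 1) choose b"
  using assms(2)
proof (induction b rule: dec_induct)
  case base
  then show ?case by simp
next
  case (step b)
  have "m + Suc b - 1 = Suc (m + b - 1)" using assms(1) by simp
  then have "(m + Suc b - 1) choose Suc b =
      ((m + b - 1) choose b) + ((m + b - 1) choose Suc b)"
    by (simp only: binomial_Suc_Suc)
  then show ?case using step.IH by linarith
qed

text \<open>
  The space of symmetric tensors of order \<open>b + 1\<close> is large enough for the even case: Pascal's rule
  reduces this to \<open>m - 2 \<le> (m + b - 1) choose (b + 1)\<close>.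
\<close>

lemma choose_step_bound:
  fixes m b :: nat
  assumes "2 \<le> m"
  shows "((m + b - 1) choose b) + m \<le> ((m + (b + 1) - 1) choose (b + 1)) + 2"
proof -
  have "m + (b + 1) - 1 = Suc (m + b - 1)" using assms by simp
  then have split: "(m + (b + 1) - 1) choose (b + 1) =
      ((m + b - 1) choose b) + ((m + b - 1) choose (b + 1))"
    by (simp only: Suc_eq_plus1[symmetric] binomial_Suc_Suc)
  have "m - 2 \<le> (m + b - 1) choose (b + 1)"
  proof (cases "m = 2")
    case False
    then have "m - 2 \<le> (m - 1) + (b + 1) - 1" "2 \<le> m - 1" using assms by auto
    then show ?thesis using le_choose_add_sub[of "m - 1" "b + 1"] assms by (simp add: add.commute)
  qed simp
  then show ?thesis unfolding split using assms by linarith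
qed

lemma power_step_bound:
  fixes m b :: nat
  assumes "1 \<le> m"
  shows "m ^ b + m \<le> m ^ (b + 1) + 2"
proof -
  obtain m' where m': "m = Suc m'" using assms by (cases m) auto
  have "m ^ b \<noteq> 0" using assms by simp
  then obtain N' where N': "m ^ b = Suc N'" by (cases "m ^ b") auto
  have "m ^ (b + 1) = m * m ^ b" by simp
  then show ?thesis unfolding N' by (simp add: m')
qed

lemma generic_imp_kruskal_condition:
  fixes x :: "nat \<Rightarrow> nat \<Rightarrow> 'a::field ^ 'm::finite"
  assumes "generic 1 b c r x"
    and "\<And>p. 2 \<le> p \<Longrightarrow> p \<le> r \<Longrightarrow> 2 * p + 2 \<le>
      min (min CARD('m) r) p + min (min (CARD('m) ^ b) r) p + min (min (CARD('m) ^ c) r) p"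
  shows "kruskal_condition b c r x"
proof (rule kruskal_condition_of_any_independent)
  show "any_independent (min CARD('m) r) r (tensor_segment x 1 1)"
    using assms(1) unfolding generic_def by simp
  have "(1::nat) + 1 = 2" "1 + b = b + 1" "1 + b + 1 = b + 2" by simp_all
  then show "any_independent (min (CARD('m) ^ b) r) r (tensor_segment x 2 (b + 1))"
    "any_independent (min (CARD('m) ^ c) r) r (tensor_segment x (b + 2) (1 + b + c))"
    using assms(1) unfolding generic_def by metis+
qed (rule assms(2))

lemma symmetric_generic_imp_kruskal_condition:
  fixes u :: "nat \<Rightarrow> 'a::field ^ 'm::finite"
  assumes dec: "symmetric_decomposition d s t u S" and gen: "symmetric_generic 1 b c s t u"
    and ineq: "\<And>p. 2 \<le> p \<Longrightarrow> p \<le> s \<Longrightarrow> 2 * p + 2 \<le> min (min CARD('m) s) p +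
      min (min ((CARD('m) + b - 1) choose b) s) p + min (min ((CARD('m) + c - 1) choose c) s) p"
  shows "kruskal_condition b c s (absorb_coefficients t u)"
proof -
  have ind: "any_independent (min ((CARD('m) + e - 1) choose e) s) s (\<lambda>j. tensor_power e (u j))"
    if "e \<in> {1, b, c}" for e
    using gen that unfolding symmetric_generic_def by blast
  have "any_independent (min CARD('m) s) s (\<lambda>j. tensor_power 1 (u j))"
    using ind[of 1] by simp
  then show ?thesis
    by (rule symmetric_kruskal_condition[OF dec _ ind ind ineq]) auto
qed

theorem theorem7p6:
  fixes T S :: "('a::field, 'm::finite) tensor"
    and x :: "nat \<Rightarrow> nat \<Rightarrow> 'a ^ 'm"
    and t :: "nat \<Rightarrow> 'a" and u :: "nat \<Rightarrow> 'a ^ 'm"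
    and m d r s :: nat
  assumes "m = CARD('m)" and "m \<ge> 2" and "d \<ge> 3"
    and "T \<in> tensors d" and "T \<noteq> 0"
    and "S \<in> symmetric_tensors d" and "S \<noteq> 0"
    and "decomposition d r x T"
    and "symmetric_decomposition d s t u S"
    and "generic 1 (nat \<lfloor>(real d - 1) / 2\<rfloor>) (nat \<lceil>(real d - 1) / 2\<rceil>) r x"
    and "symmetric_generic 1 (nat \<lfloor>(real d - 1) / 2\<rfloor>) (nat \<lceil>(real d - 1) / 2\<rceil>) s t u"
  shows
    "(\<forall>b. d = 2 * b + 1 \<longrightarrow>
        (real r \<le> real m ^ b + (real m - 2) / 2 \<longrightarrow> tensor_rank d T = r) \<and>
        (real s \<le> real ((m + b - 1) choose b) + (real m - 2) / 2 \<longrightarrow>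
           tensor_rank d S = s \<and> symmetric_rank d S = s)) \<and>
     (\<forall>b. d = 2 * b + 2 \<longrightarrow>
        (r \<le> m ^ b + m - 2 \<longrightarrow> tensor_rank d T = r) \<and>
        (s \<le> ((m + b - 1) choose b) + m - 2 \<longrightarrow>
           tensor_rank d S = s \<and> symmetric_rank d S = s)) \<and>
     (\<forall>b. (d = 2 * b + 1 \<and> real r \<le> real m ^ b + (real m - 2) / 2) \<or>
          (d = 2 * b + 2 \<and> r \<le> m ^ b + m - 2) \<longrightarrow>
        unique_rank_one_sum d r T) \<and>
     (\<forall>b. (d = 2 * b + 1 \<and> real s \<le> real ((m + b - 1) choose b) + (real m - 2) / 2) \<or>
          (d = 2 * b + 2 \<and> s \<le> ((m + b - 1) choose b) + m - 2) \<longrightarrow>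
        unique_rank_one_sum d s S)"
proof -
  note m = assms(1) and m2 = assms(2) and d3 = assms(3)
  note decT = assms(8) and decS = assms(9) and genT = assms(10) and genS = assms(11)
  note decS' = decomposition_absorb_coefficients[OF decS]
  have halves_odd: "nat \<lfloor>(real d - 1) / 2\<rfloor> = b" "nat \<lceil>(real d - 1) / 2\<rceil> = b" if "d = 2 * b + 1" for b
    using that by simp_all
  have halves_even: "nat \<lfloor>(real d - 1) / 2\<rfloor> = b" "nat \<lceil>(real d - 1) / 2\<rceil> = b + 1"
    if "d = 2 * b + 2" for b
  proof -
    have half: "(real d - 1) / 2 = real b + 1 / 2" using that by (simp add: field_simps)
    have "\<lfloor>real b + 1 / 2\<rfloor> = int b" "\<lceil>real b + 1 / 2\<rceil> = int (b + 1)"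
      by linarith+
    then show "nat \<lfloor>(real d - 1) / 2\<rfloor> = b" "nat \<lceil>(real d - 1) / 2\<rceil> = b + 1"
      unfolding half by (simp_all only: nat_int)
  qed
  have double: "2 * q + 2 \<le> 2 * N + m" if "real q \<le> real N + (real m - 2) / 2" for q N
  proof -
    have "real (2 * q + 2) \<le> real (2 * N + m)" using that by (simp add: field_simps)
    then show ?thesis by (simp only: of_nat_le_iff)
  qed

  have T_odd: "kruskal_condition b b r x"
    if d: "d = 2 * b + 1" and r: "real r \<le> real m ^ b + (real m - 2) / 2" for b
  proof (rule generic_imp_kruskal_condition)
    show "generic 1 b b r x" using genT unfolding halves_odd[OF d] .
    have "m ^ 1 \<le> m ^ b" using m2 d d3 by (intro power_increasing) auto
    moreover have "2 * r + 2 \<le> 2 * m ^ b + m" using r by (intro double) simp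
    ultimately show "2 * p + 2 \<le> min (min CARD('m) r) p + min (min (CARD('m) ^ b) r) p
        + min (min (CARD('m) ^ b) r) p" if "2 \<le> p" "p \<le> r" for p
      using kruskal_inequality_odd[OF m2 _ that] m by simp
  qed
  have T_even: "kruskal_condition b (b + 1) r x"
    if d: "d = 2 * b + 2" and r: "r \<le> m ^ b + m - 2" for b
  proof (rule generic_imp_kruskal_condition)
    show "generic 1 b (b + 1) r x" using genT unfolding halves_even[OF d] .
    have "m ^ 1 \<le> m ^ b" using m2 d d3 by (intro power_increasing) auto
    moreover have "r + 2 \<le> m ^ b + m" using r m2 by linarith
    moreover have "m ^ b + m \<le> m ^ (b + 1) + 2" using m2 by (intro power_step_bound) simp
    ultimately show "2 * p + 2 \<le> min (min CARD('m) r) p + min (min (CARD('m) ^ b) r) p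
        + min (min (CARD('m) ^ (b + 1)) r) p" if "2 \<le> p" "p \<le> r" for p
      unfolding m[symmetric] by (intro kruskal_inequality_even[OF m2 _ that]) simp_all
  qed
  have S_odd: "kruskal_condition b b s (absorb_coefficients t u)"
    if d: "d = 2 * b + 1" and s: "real s \<le> real ((m + b - 1) choose b) + (real m - 2) / 2" for b
  proof (rule symmetric_generic_imp_kruskal_condition[OF decS])
    show "symmetric_generic 1 b b s t u" using genS unfolding halves_odd[OF d] .
    have "m \<le> (m + b - 1) choose b" using m2 d d3 by (intro le_choose_add_sub) auto
    moreover have "2 * s + 2 \<le> 2 * ((m + b - 1) choose b) + m" using s by (rule double)
    ultimately show "2 * p + 2 \<le> min (min CARD('m) s) p
        + min (min ((CARD('m) + b - 1) choose b) s) p + min (min ((CARD('m) + b - 1) choose b) s) p"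
      if "2 \<le> p" "p \<le> s" for p
      unfolding m[symmetric] by (intro kruskal_inequality_odd[OF m2 _ that])
  qed
  have S_even: "kruskal_condition b (b + 1) s (absorb_coefficients t u)"
    if d: "d = 2 * b + 2" and s: "s \<le> ((m + b - 1) choose b) + m - 2" for b
  proof (rule symmetric_generic_imp_kruskal_condition[OF decS])
    show "symmetric_generic 1 b (b + 1) s t u" using genS unfolding halves_even[OF d] .
    have "m \<le> (m + b - 1) choose b" using m2 d d3 by (intro le_choose_add_sub) auto
    moreover have "s + 2 \<le> ((m + b - 1) choose b) + m" using s m2 by linarith
    moreover note choose_step_bound[OF m2, of b]
    ultimately show "2 * p + 2 \<le> min (min CARD('m) s) p
        + min (min ((CARD('m) + b - 1) choose b) s) p
        + min (min ((CARD('m) + (b + 1) - 1) choose (b + 1)) s) p"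
      if "2 \<le> p" "p \<le> s" for p
      unfolding m[symmetric] by (intro kruskal_inequality_even[OF m2 _ that])
  qed

  have d1: "1 \<le> d" using d3 by simp
  have odd_sum: "d = 1 + b + b" if "d = 2 * b + 1" for b using that by simp
  have even_sum: "d = 1 + b + (b + 1)" if "d = 2 * b + 2" for b using that by simp
  note T_rank = kruskal_condition_imp_rank[OF decT]
    and T_unique = kruskal_condition_imp_unique[OF decT]
    and S_rank = kruskal_condition_imp_rank[OF decS'[OF d1]]
    and S_symmetric_rank = symmetric_rank_eq[OF decS]
    and S_unique = kruskal_condition_imp_unique[OF decS'[OF d1]]
  show ?thesis
  proof (intro conjI allI impI)
    fix b
    assume d: "d = 2 * b + 1"
    show "tensor_rank d T = r" if "real r \<le> real m ^ b + (real m - 2) / 2"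
      using T_rank[OF odd_sum[OF d] T_odd[OF d that]] .
    show "tensor_rank d S = s" "symmetric_rank d S = s"
      if "real s \<le> real ((m + b - 1) choose b) + (real m - 2) / 2"
      using S_rank[OF odd_sum[OF d] S_odd[OF d that]]
        S_symmetric_rank[OF odd_sum[OF d] S_odd[OF d that]] .
  next
    fix b
    assume d: "d = 2 * b + 2"
    show "tensor_rank d T = r" if "r \<le> m ^ b + m - 2"
      using T_rank[OF even_sum[OF d] T_even[OF d that]] .
    show "tensor_rank d S = s" "symmetric_rank d S = s" if "s \<le> ((m + b - 1) choose b) + m - 2"
      using S_rank[OF even_sum[OF d] S_even[OF d that]]
        S_symmetric_rank[OF even_sum[OF d] S_even[OF d that]] .
  next
    fix b
    assume "(d = 2 * b + 1 \<and> real r \<le> real m ^ b + (real m - 2) / 2) \<or>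
      (d = 2 * b + 2 \<and> r \<le> m ^ b + m - 2)"
    then show "unique_rank_one_sum d r T"
      using T_unique[OF odd_sum T_odd] T_unique[OF even_sum T_even] by blast
  next
    fix b
    assume "(d = 2 * b + 1 \<and> real s \<le> real ((m + b - 1) choose b) + (real m - 2) / 2) \<or>
      (d = 2 * b + 2 \<and> s \<le> ((m + b - 1) choose b) + m - 2)"
    then show "unique_rank_one_sum d s S"
      using S_unique[OF odd_sum S_odd] S_unique[OF even_sum S_even] by blast
  qed
qed

end
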